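(* Assume $\mathrm{char}(\mathbb F)=0$ and $0\ne h\in R=\mathbb F[x]$. Let $\mathcal D=\{D_g\mid g\in R,\ \deg g<\deg h\}$ and $\mathcal E=\{\mathrm{ad}_a\mid a\in \mathsf N_{A_1}(A_h)\}$. Then, as vector spaces over $\mathbb F$: (i) $\mathcal E=\mathrm{span}_{\mathbb F}\{\mathrm{ad}_{ra_n}\mid r\in R,\ \deg r<\deg\frac{h}{\pi_h},\ n\ge1\}\oplus\mathrm{Inder}_{\mathbb F}(A_h)$. (ii) $\mathrm{Der}_{\mathbb F}(A_h)=\mathcal D\oplus\mathrm{span}_{\mathbb F}\{\mathrm{ad}_{ra_n}\mid r\in R,\ \deg r<\deg\frac{h}{\pi_h},\ n\ge1\}\oplus\mathrm{Inder}_{\mathbb F}(A_h)$. (iii) $\mathsf{HH}^1(A_h)\cong\mathcal D\oplus\mathrm{span}_{\mathbb F}\{\mathrm{ad}_{ra_n}\mid r\in R,\ \deg r<\deg\frac{h}{\pi_h},\ n\ge1\}$.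
   Context: $\mathbb F$ is a field, $R=\mathbb F[x]$, $0\ne h\in R$. The Weyl algebra $A_1$ is the unital associative $\mathbb F$-algebra with generators $x,y$ and relation $yx-xy=1$. $A_h$ is the unital associative $\mathbb F$-algebra with generators $x,\hat y$ and relation $\hat yx-x\hat y=h$; it is identified with the subalgebra of $A_1$ generated by $x$ and $\hat y=yh$. With $\mathrm{ad}_u(v)=[u,v]=uv-vu$, the normalizer is $\mathsf N_{A_1}(A_h)=\{u\in A_1\mid [u,A_h]\subseteq A_h\}$; for $u$ in it, $\mathrm{ad}_u$ is regarded as a derivation of $A_h$. $\mathsf{HH}^1(A_h)=\mathrm{Der}_{\mathbb F}(A_h)/\mathrm{Inder}_{\mathbb F}(A_h)$ (derivations modulo inner derivations); in (iii), derivations are identified with their images in the quotient. For $g\in R$, $D_g$ is the derivation of $A_h$ with $D_g(x)=0$, $D_g(\hat y)=g$. $\pi_h\in R$ is the unique monic polynomial such that for all $r\in R$: $h\mid h'r\iff\pi_h\mid r$ (in characteristic 0, the product of the distinct monic prime factors of $h$; $1$ if $h$ is constant). $a_n=\pi_hh^{n-1}y^n$ for $n\ge1$; these lie in $\mathsf N_{A_1}(A_h)$, as do all $ra_n$, $r\in R$. $\deg 0=-\infty$. *)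

theory Defs
  imports
    "HOL-Computational_Algebra.Polynomial"
    "HOL-Library.Function_Algebras"
    "HOL-Library.Set_Algebras"
begin

section \<open>The Weyl algebra\<close>

text \<open>
  The algebra presented by generators \<open>x\<close>, \<open>y\<close> and the relation \<open>y x - x y = 1\<close>: formal
  expressions in the generators and the scalars, modulo the least congruence that contains
  the axioms of unital associative algebras and the relation. Scalars \<open>c\<close> are
  identified with \<open>c \<cdot> 1\<close>, so that scalar multiplication by \<open>c\<close> is left multiplication by
  \<open>c \<cdot> 1\<close>.
\<close>

datatype 'f wexp =
    Cst 'f
  | GenX
  | GenY
  | Add "'f wexp" "'f wexp"
  | Mul "'f wexp" "'f wexp"

inductive weyl_cong :: "'f::field wexp \<Rightarrow> 'f wexp \<Rightarrow> bool" where
  refl: "weyl_cong s s"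
| sym: "weyl_cong s t \<Longrightarrow> weyl_cong t s"
| trans: "weyl_cong s t \<Longrightarrow> weyl_cong t u \<Longrightarrow> weyl_cong s u"
| cong_add: "weyl_cong s s' \<Longrightarrow> weyl_cong t t' \<Longrightarrow> weyl_cong (Add s t) (Add s' t')"
| cong_mul: "weyl_cong s s' \<Longrightarrow> weyl_cong t t' \<Longrightarrow> weyl_cong (Mul s t) (Mul s' t')"
| add_assoc: "weyl_cong (Add (Add s t) u) (Add s (Add t u))"
| add_commute: "weyl_cong (Add s t) (Add t s)"
| zero_add: "weyl_cong (Add (Cst 0) s) s"
| mul_assoc: "weyl_cong (Mul (Mul s t) u) (Mul s (Mul t u))"
| one_mul: "weyl_cong (Mul (Cst 1) s) s"
| zero_mul: "weyl_cong (Mul (Cst 0) s) (Cst 0)"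
| distrib_right: "weyl_cong (Mul (Add s t) u) (Add (Mul s u) (Mul t u))"
| distrib_left: "weyl_cong (Mul s (Add t u)) (Add (Mul s t) (Mul s u))"
| cst_add: "weyl_cong (Cst (a + b)) (Add (Cst a) (Cst b))"
| cst_mul: "weyl_cong (Cst (a * b)) (Mul (Cst a) (Cst b))"
| cst_central: "weyl_cong (Mul (Cst a) s) (Mul s (Cst a))"
| weyl_rel: "weyl_cong (Mul GenY GenX) (Add (Mul GenX GenY) (Cst 1))"

lemma equivp_weyl_cong: "equivp weyl_cong"
  by (intro equivpI reflpI sympI transpI) (blast intro: weyl_cong.refl weyl_cong.sym weyl_cong.trans)+

quotient_type (overloaded) 'f weyl = "'f::field wexp" / weyl_cong
  by (rule equivp_weyl_cong)

lift_definition wconst :: "'f::field \<Rightarrow> 'f weyl" is Cst .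
lift_definition wx :: "'f::field weyl" is GenX .
lift_definition wy :: "'f::field weyl" is GenY .

text \<open>The action on polynomials, with \<open>y\<close> acting as the derivative, shows \<open>0 \<noteq> 1\<close>.\<close>

primrec wact :: "'f::field wexp \<Rightarrow> 'f poly \<Rightarrow> 'f poly" where
  "wact (Cst c) p = smult c p"
| "wact GenX p = pCons 0 p"
| "wact GenY p = pderiv p"
| "wact (Add s t) p = wact s p + wact t p"
| "wact (Mul s t) p = wact s (wact t p)"

lemma wact_add: "wact s (p + q) = wact s p + wact s q"
  by (induction s arbitrary: p q) (simp_all add: smult_add_right pderiv_add)

lemma wact_smult: "wact s (smult c p) = smult c (wact s p)"
  by (induction s arbitrary: p) (simp_all add: smult_add_right pderiv_smult mult.commute)

lemma weyl_cong_wact: "weyl_cong s t \<Longrightarrow> wact s p = wact t p"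
  by (induction arbitrary: p rule: weyl_cong.induct)
    (simp_all add: wact_add wact_smult smult_add_left add_ac mult.commute pderiv_pCons)

instantiation weyl :: (field) ring_1
begin

lift_definition zero_weyl :: "'a weyl" is "Cst 0" .
lift_definition one_weyl :: "'a weyl" is "Cst 1" .
lift_definition plus_weyl :: "'a weyl \<Rightarrow> 'a weyl \<Rightarrow> 'a weyl" is Add by (rule cong_add)
lift_definition times_weyl :: "'a weyl \<Rightarrow> 'a weyl \<Rightarrow> 'a weyl" is Mul by (rule cong_mul)
lift_definition uminus_weyl :: "'a weyl \<Rightarrow> 'a weyl" is "Mul (Cst (-1))"
  by (blast intro: cong_mul weyl_cong.refl)
definition minus_weyl :: "'a weyl \<Rightarrow> 'a weyl \<Rightarrow> 'a weyl" where
  "minus_weyl a b = a + (- b)"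

instance
proof
  fix a b c :: "'a weyl"
  show "a + b + c = a + (b + c)" by transfer (rule weyl_cong.intros)
  show "a + b = b + a" by transfer (rule weyl_cong.intros)
  show "0 + a = a" by transfer (rule weyl_cong.intros)
  show "a * b * c = a * (b * c)" by transfer (rule weyl_cong.intros)
  show "1 * a = a" by transfer (rule weyl_cong.intros)
  show "a * 1 = a"
    by transfer (blast intro: cst_central one_mul weyl_cong.sym weyl_cong.trans)
  show "(a + b) * c = a * c + b * c" by transfer (rule weyl_cong.intros)
  show "a * (b + c) = a * b + a * c" by transfer (rule weyl_cong.intros)
  show "a - b = a + - b" by (rule minus_weyl_def)
  show "- a + a = 0"
  proof transfer
    fix s :: "'a wexp"
    have 1: "weyl_cong (Add (Mul (Cst (-1)) s) s) (Add (Mul (Cst (-1)) s) (Mul (Cst 1) s))"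
      by (blast intro: cong_add weyl_cong.refl weyl_cong.sym one_mul)
    have 2: "weyl_cong (Add (Mul (Cst (-1)) s) (Mul (Cst 1) s)) (Mul (Add (Cst (-1)) (Cst 1)) s)"
      by (blast intro: weyl_cong.sym distrib_right)
    have "weyl_cong (Cst (-1 + 1 :: 'a)) (Add (Cst (-1)) (Cst 1))"
      by (rule cst_add)
    then have 3: "weyl_cong (Mul (Add (Cst (-1)) (Cst 1)) s) (Mul (Cst 0) s)"
      by (auto intro!: cong_mul weyl_cong.refl intro: weyl_cong.sym)
    show "weyl_cong (Add (Mul (Cst (-1)) s) s) (Cst 0)"
      by (blast intro: 1 2 3 zero_mul weyl_cong.trans)
  qed
  show "(0::'a weyl) \<noteq> 1" 
  proof transfer
    show "\<not> weyl_cong (Cst 0) (Cst (1::'a))"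
      using weyl_cong_wact[of "Cst 0" "Cst (1::'a)" 1] by auto
  qed
qed

end

lemma wconst_one: "wconst 1 = 1"
  by transfer (rule weyl_cong.refl)

lemma wconst_add: "wconst (a + b) = wconst a + wconst b"
  by transfer (rule cst_add)

lemma wconst_mult: "wconst (a * b) = wconst a * wconst b"
  by transfer (rule cst_mul)

lemma wconst_central: "wconst c * a = a * wconst c"
  by transfer (rule cst_central)

lemma wy_wx: "wy * wx = wx * wy + 1"
  by transfer (rule weyl_rel)

text \<open>The universal property of the presentation\<close>

lemma weyl_universal:
  fixes emb :: "'f::field \<Rightarrow> 'b::ring_1" and X Y :: 'b
  assumes "emb 1 = 1" "\<And>a b. emb (a + b) = emb a + emb b" "\<And>a b. emb (a * b) = emb a * emb b"
    and central: "\<And>a z. emb a * z = z * emb a"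
    and rel: "Y * X - X * Y = 1"
  shows "\<exists>!F :: 'f weyl \<Rightarrow> 'b. (\<forall>a b. F (a + b) = F a + F b) \<and> (\<forall>a b. F (a * b) = F a * F b)
    \<and> (\<forall>c. F (wconst c) = emb c) \<and> F wx = X \<and> F wy = Y"
proof -
  define ev where "ev = rec_wexp emb X Y (\<lambda>_ _ u v. u + v) (\<lambda>_ _ u v. u * v)"
  have ev [simp]: "ev (Cst c) = emb c" "ev GenX = X" "ev GenY = Y" "ev (Add s t) = ev s + ev t"
    "ev (Mul s t) = ev s * ev t" for c s t
    by (simp_all add: ev_def)
  have emb0: "emb 0 = 0"
    using assms(2)[of 0 0] by simp
  have rel': "Y * X = X * Y + 1"
    using rel by (simp add: algebra_simps)
  have cong: "ev s = ev t" if "weyl_cong s t" for s t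
    using that
  proof (induction rule: weyl_cong.induct)
    case (cst_central a s)
    show ?case using central by simp
  qed (simp_all add: assms(1-3) emb0 rel' algebra_simps)
  define F where "F a = ev (rep_weyl a)" for a
  have F: "F (abs_weyl s) = ev s" for s
    unfolding F_def by (intro cong Quotient3_rep_abs[OF Quotient3_weyl] weyl_cong.refl)
  have abs: "\<exists>s. a = abs_weyl s" for a :: "'f weyl"
    using Quotient3_abs_rep[OF Quotient3_weyl, of a] by metis
  show ?thesis
  proof (rule ex1I[of _ F], intro conjI allI)
    fix a b :: "'f weyl"
    obtain s t where st: "a = abs_weyl s" "b = abs_weyl t"
      using abs by metis
    show "F (a + b) = F a + F b" "F (a * b) = F a * F b"
      unfolding st plus_weyl.abs_eq times_weyl.abs_eq F by simp_all
  next
    fix G :: "'f weyl \<Rightarrow> 'b"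
    assume G: "(\<forall>a b. G (a + b) = G a + G b) \<and> (\<forall>a b. G (a * b) = G a * G b)
      \<and> (\<forall>c. G (wconst c) = emb c) \<and> G wx = X \<and> G wy = Y"
    have "G (abs_weyl s) = ev s" for s
    proof (induction s)
      case (Cst c) then show ?case using G by (simp flip: wconst.abs_eq)
    next
      case GenX then show ?case using G by (simp flip: wx.abs_eq)
    next
      case GenY then show ?case using G by (simp flip: wy.abs_eq)
    next
      case (Add s t) then show ?case using G by (simp flip: plus_weyl.abs_eq)
    next
      case (Mul s t) then show ?case using G by (simp flip: times_weyl.abs_eq)
    qed
    with F abs show "G = F" by (metis ext)
  qed (simp_all add: F wconst.abs_eq wx.abs_eq wy.abs_eq)
qed

definition wscale :: "'f::field \<Rightarrow> 'f weyl \<Rightarrow> 'f weyl" where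
  "wscale c a = wconst c * a"

definition wpoly :: "'f::field poly \<Rightarrow> 'f weyl" where
  "wpoly p = (\<Sum>i\<le>degree p. wscale (coeff p i) (wx ^ i))"

definition commutator :: "'f::field weyl \<Rightarrow> 'f weyl \<Rightarrow> 'f weyl" where
  "commutator u v = u * v - v * u"


section \<open>The algebra \<open>A\<^sub>h\<close> and its derivations\<close>

text \<open>\<open>A\<^sub>h\<close> is the subalgebra generated by \<open>x\<close> and \<open>y h\<close>; closure under scalar multiples and
  negation follows from closure under multiplication by constants.\<close>

definition yhat :: "'f::field poly \<Rightarrow> 'f weyl" where
  "yhat h = wy * wpoly h"

inductive_set Ah :: "'f::field poly \<Rightarrow> 'f weyl set" for h where
  const: "wconst c \<in> Ah h"
| x: "wx \<in> Ah h"
| yhat: "yhat h \<in> Ah h"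
| add: "a \<in> Ah h \<Longrightarrow> b \<in> Ah h \<Longrightarrow> a + b \<in> Ah h"
| mult: "a \<in> Ah h \<Longrightarrow> b \<in> Ah h \<Longrightarrow> a * b \<in> Ah h"

definition normalizer :: "'f::field poly \<Rightarrow> 'f weyl set" where
  "normalizer h = {u. \<forall>v \<in> Ah h. commutator u v \<in> Ah h}"

definition fscale :: "'f::field \<Rightarrow> ('f weyl \<Rightarrow> 'f weyl) \<Rightarrow> 'f weyl \<Rightarrow> 'f weyl" where
  "fscale c f = (\<lambda>a. wscale c (f a))"

global_interpretation maps: vector_space fscale
  by unfold_locales
    (simp_all add: fscale_def wscale_def fun_eq_iff wconst_add wconst_mult wconst_one
      algebra_simps)

text \<open>
  Maps \<open>A\<^sub>h \<rightarrow> A\<^sub>h\<close> are represented by functions on the whole Weyl algebra that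
  vanish outside \<open>A\<^sub>h\<close>, so that equality of maps on \<open>A\<^sub>h\<close> is equality of functions
  and the vector space operations are the pointwise ones.
\<close>

definition Der :: "'f::field poly \<Rightarrow> ('f weyl \<Rightarrow> 'f weyl) set" where
  "Der h = {d. (\<forall>a \<in> Ah h. d a \<in> Ah h)
    \<and> (\<forall>a \<in> Ah h. \<forall>b \<in> Ah h. d (a + b) = d a + d b)
    \<and> (\<forall>c. \<forall>a \<in> Ah h. d (wscale c a) = wscale c (d a))
    \<and> (\<forall>a \<in> Ah h. \<forall>b \<in> Ah h. d (a * b) = d a * b + a * d b)
    \<and> (\<forall>a. a \<notin> Ah h \<longrightarrow> d a = 0)}"

definition ad :: "'f::field poly \<Rightarrow> 'f weyl \<Rightarrow> 'f weyl \<Rightarrow> 'f weyl" where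
  "ad h u = (\<lambda>v. if v \<in> Ah h then commutator u v else 0)"

definition Inder :: "'f::field poly \<Rightarrow> ('f weyl \<Rightarrow> 'f weyl) set" where
  "Inder h = ad h ` Ah h"

text \<open>The derivation \<open>D\<^sub>g\<close>; the two values determine it since \<open>A\<^sub>h\<close> is generated by \<open>x\<close> and \<open>y h\<close>.\<close>

definition D :: "'f::field poly \<Rightarrow> 'f poly \<Rightarrow> 'f weyl \<Rightarrow> 'f weyl" where
  "D h g = (THE d. d \<in> Der h \<and> d wx = 0 \<and> d (yhat h) = wpoly g)"

text \<open>\<open>deg p < deg q\<close> with the convention \<open>deg 0 = -\<infinity>\<close>\<close>

definition deg_less :: "'f::zero poly \<Rightarrow> 'f poly \<Rightarrow> bool" where
  "deg_less p q \<longleftrightarrow> q \<noteq> 0 \<and> (p = 0 \<or> degree p < degree q)"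

definition pi_poly :: "'f::field poly \<Rightarrow> 'f poly" where
  "pi_poly h = (THE p. lead_coeff p = 1 \<and> (\<forall>r. h dvd pderiv h * r \<longleftrightarrow> p dvd r))"

definition a_elem :: "'f::field poly \<Rightarrow> nat \<Rightarrow> 'f weyl" where
  "a_elem h n = wpoly (pi_poly h * h ^ (n - 1)) * wy ^ n"

definition DD :: "'f::field poly \<Rightarrow> ('f weyl \<Rightarrow> 'f weyl) set" where
  "DD h = {D h g | g. deg_less g h}"

definition EE :: "'f::field poly \<Rightarrow> ('f weyl \<Rightarrow> 'f weyl) set" where
  "EE h = ad h ` normalizer h"

definition span_ad :: "'f::field poly \<Rightarrow> ('f weyl \<Rightarrow> 'f weyl) set" where
  "span_ad h = maps.span {ad h (wpoly r * a_elem h n) | r n. deg_less r (h div pi_poly h) \<and> n \<ge> 1}"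


section \<open>Direct sums and the quotient of derivations by inner derivations\<close>

text \<open>\<open>V\<close> is the internal direct sum of the listed subspaces: addition is a bijection from
  their Cartesian product onto \<open>V\<close>.\<close>

definition is_direct_sum ::
    "('f::field weyl \<Rightarrow> 'f weyl) set \<Rightarrow> ('f weyl \<Rightarrow> 'f weyl) set list \<Rightarrow> bool" where
  "is_direct_sum V Us \<longleftrightarrow>
    maps.subspace V \<and> (\<forall>U \<in> set Us. maps.subspace U) \<and> bij_betw sum_list (listset Us) V"

text \<open>
  Elements of the quotient space are cosets \<open>d + Inder h\<close>. Their sum is the elementwise
  sum of sets; for scalar multiples the subspace is added again, because of the
  scalar \<open>0\<close>.
\<close>

definition HH1 :: "'f::field poly \<Rightarrow> ('f weyl \<Rightarrow> 'f weyl) set set" where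
  "HH1 h = {d +o Inder h | d. d \<in> Der h}"

definition HH1_scale ::
    "'f::field poly \<Rightarrow> 'f \<Rightarrow> ('f weyl \<Rightarrow> 'f weyl) set \<Rightarrow> ('f weyl \<Rightarrow> 'f weyl) set" where
  "HH1_scale h c A = fscale c ` A + Inder h"

definition is_HH1_iso ::
    "'f::field poly \<Rightarrow> ('f weyl \<Rightarrow> 'f weyl) set \<Rightarrow>
      (('f weyl \<Rightarrow> 'f weyl) \<Rightarrow> ('f weyl \<Rightarrow> 'f weyl) set) \<Rightarrow> bool" where
  "is_HH1_iso h W F \<longleftrightarrow> bij_betw F W (HH1 h)
    \<and> (\<forall>d \<in> W. \<forall>e \<in> W. F (d + e) = F d + F e)
    \<and> (\<forall>c. \<forall>d \<in> W. F (fscale c d) = HH1_scale h c (F d))"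

end

theory Submission
  imports Defs "HOL-Computational_Algebra.Polynomial_FPS"
begin

text \<open>
  Every element of the Weyl algebra is a differential operator \<open>\<Sum> p\<^sub>n y\<^sup>n\<close> with coefficients on the
  left, determined by its symbol, a polynomial in \<open>x\<close> and a commuting variable for \<open>y\<close>
  (\<open>of_symbol_surj\<close>, \<open>of_symbol_eq_iff\<close>). In these coordinates \<open>[\<cdot>, x]\<close> is \<open>\<partial>/\<partial>y\<close> and \<open>[y, \<cdot>]\<close>
  is \<open>\<partial>/\<partial>x\<close>; in characteristic 0 the first is surjective, with kernel \<open>R\<close>. This drives everything.

  The subalgebra \<open>A\<^sub>h\<close> consists of the operators with \<open>h\<^sup>n\<close> dividing \<open>p\<^sub>n\<close> for all \<open>n\<close>
  (\<open>of_symbol_in_Ah_iff\<close>). An operator \<open>u\<close> normalizes \<open>A\<^sub>h\<close> iff \<open>[u, x]\<close> and \<open>[u, yh]\<close> lie in \<open>A\<^sub>h\<close>. The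
  first condition says \<open>p\<^sub>n = q\<^sub>n h\<^sup>n\<^sup>-\<^sup>1\<close> for \<open>n \<ge> 1\<close>; then \<open>[u, yh]\<close> is \<open>\<Sum> q\<^sub>n h' h\<^sup>n\<^sup>-\<^sup>1 y\<^sup>n\<close> modulo
  \<open>A\<^sub>h\<close>, so the second says \<open>h dvd h' q\<^sub>n\<close>, that is \<open>\<pi>\<^sub>h dvd q\<^sub>n\<close> (\<open>of_symbol_in_normalizer_iff\<close>).
  Dividing \<open>q\<^sub>n / \<pi>\<^sub>h\<close> with remainder by \<open>h / \<pi>\<^sub>h\<close> splits the normalizer as the span of the
  \<open>r a\<^sub>n\<close> plus \<open>A\<^sub>h\<close>. An operator acts trivially only if it commutes with \<open>x\<close>, so lies in
  \<open>R \<subseteq> A\<^sub>h\<close>; hence the splitting survives the passage to derivations, which is (i).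

  For (ii), let \<open>d\<close> be a derivation of \<open>A\<^sub>h\<close> and choose an operator \<open>u\<close> with \<open>[u, x] = d x\<close>. The
  difference of \<open>d\<close> and \<open>ad u\<close> kills \<open>x\<close>, so the relation between the generators forces its
  value at \<open>yh\<close> to commute with \<open>x\<close>: it is a polynomial \<open>g\<close>. Thus \<open>[u, yh] = d (yh) - g\<close> lies in
  \<open>A\<^sub>h\<close>, so \<open>u\<close> is automatically in the normalizer and \<open>d = D\<^sub>g + ad u\<close> (\<open>Der_decompose\<close>). Since
  \<open>[p, yh] = - h p'\<close> and every polynomial is a derivative, \<open>g\<close> matters only modulo \<open>h\<close>; this also
  shows that no nonzero \<open>D\<^sub>g\<close> with \<open>deg g < deg h\<close> is of the form \<open>ad u\<close> (\<open>DD_Int_EE\<close>). The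
  derivation \<open>D\<^sub>g\<close> exists because it is the commutator with an antiderivative of \<open>- g / h\<close>,
  which makes sense among power series at a point where \<open>h\<close> does not vanish (\<open>D_exists\<close>).
  Part (iii) is (ii) read modulo the inner derivations.
\<close>

section \<open>Polynomials inside the Weyl algebra\<close>

declare wconst_one [simp]

lemma wconst_zero [simp]: "wconst 0 = 0"
  using wconst_add[of 0 0] by simp

lemma wconst_minus: "wconst (- c) = - wconst c"
  using wconst_add[of c "- c"] by (simp add: eq_neg_iff_add_eq_0 add.commute)

lemma sum_coeff_extend:
  fixes f :: "'a::zero \<Rightarrow> 'b::comm_monoid_add"
  assumes "degree p \<le> n" "\<And>i. g i 0 = 0"
  shows "(\<Sum>i\<le>degree p. g i (coeff p i)) = (\<Sum>i\<le>n. g i (coeff p i))"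
  by (rule sum.mono_neutral_left) (use assms in \<open>auto simp: coeff_eq_0\<close>)

lemma wpoly_upto: "degree p \<le> n \<Longrightarrow> wpoly p = (\<Sum>i\<le>n. wscale (coeff p i) (wx ^ i))"
  unfolding wpoly_def
  using sum_coeff_extend[of p n "\<lambda>i c. wscale c (wx ^ i)"] by (simp add: wscale_def)

lemma wpoly_0 [simp]: "wpoly 0 = 0"
  by (simp add: wpoly_def wscale_def)

lemma wpoly_pCons [simp]: "wpoly (pCons c p) = wconst c + wx * wpoly p"
proof -
  have "wpoly (pCons c p) = (\<Sum>i\<le>Suc (degree p). wscale (coeff (pCons c p) i) (wx ^ i))"
    by (rule wpoly_upto) (simp add: degree_pCons_le)
  also have "\<dots> = wconst c + (\<Sum>i\<le>degree p. wscale (coeff p i) (wx ^ Suc i))"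
    by (subst sum.atMost_Suc_shift) (simp add: wscale_def)
  also have "(\<Sum>i\<le>degree p. wscale (coeff p i) (wx ^ Suc i)) = wx * wpoly p"
    unfolding wpoly_def sum_distrib_left wscale_def
    by (intro sum.cong) (simp_all add: wconst_central mult.assoc)
  finally show ?thesis .
qed

lemma wpoly_const: "wpoly [:c:] = wconst c"
  by simp

lemma wpoly_1 [simp]: "wpoly 1 = 1"
  by (simp add: one_pCons)

lemma wpoly_add: "wpoly (p + q) = wpoly p + wpoly q"
proof -
  let ?n = "max (degree p) (degree q)"
  show ?thesis
    by (subst (1 2 3) wpoly_upto[where n = ?n])
      (auto simp: degree_add_le_max sum.distrib wscale_def wconst_add ring_distribs)
qed

lemma wpoly_smult: "wpoly (smult c p) = wconst c * wpoly p"
proof (induction p)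
  case (pCons a p)
  have "wx * (wconst c * z) = wconst c * (wx * z)" for z
    by (metis mult.assoc wconst_central)
  with pCons show ?case
    by (simp add: wconst_mult ring_distribs)
qed simp

lemma wpoly_mult: "wpoly (p * q) = wpoly p * wpoly q"
  by (induction p) (simp_all add: wpoly_add wpoly_smult ring_distribs mult.assoc)

lemma wpoly_minus: "wpoly (- p) = - wpoly p"
  using wpoly_add[of p "- p"] by (simp add: eq_neg_iff_add_eq_0 add.commute)

lemma wpoly_commute: "wpoly p * wpoly q = wpoly q * wpoly p"
  by (metis mult.commute wpoly_mult)

lemma wx_eq_wpoly: "wx = wpoly [:0, 1:]"
  by simp

lemma wx_wpoly_commute: "wx * wpoly p = wpoly p * wx"
  unfolding wx_eq_wpoly by (rule wpoly_commute)

lemma wy_wpoly: "wy * wpoly p = wpoly p * wy + wpoly (pderiv p)"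
proof (induction p)
  case (pCons a p)
  have "wy * wpoly (pCons a p) = wconst a * wy + (wx * wy + 1) * wpoly p"
    by (simp add: ring_distribs wconst_central flip: mult.assoc wy_wx)
  also have "\<dots> = wpoly (pCons a p) * wy + wpoly (pderiv (pCons a p))"
    by (simp add: ring_distribs mult.assoc pCons pderiv_pCons wpoly_add ring_distribs)
  finally show ?case .
qed simp

section \<open>Normally ordered expressions\<close>

text \<open>
  The coefficients of the outer polynomial are the polynomials in \<open>x\<close> standing to the left of the
  powers of \<open>y\<close>.
\<close>
definition of_symbol :: "'f::field poly poly \<Rightarrow> 'f weyl" where
  "of_symbol P = (\<Sum>n\<le>degree P. wpoly (coeff P n) * wy ^ n)"

lemma of_symbol_upto:
  "degree P \<le> n \<Longrightarrow> of_symbol P = (\<Sum>i\<le>n. wpoly (coeff P i) * wy ^ i)"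
  unfolding of_symbol_def
  using sum_coeff_extend[of P n "\<lambda>i c. wpoly c * wy ^ i"] by simp

lemma of_symbol_0 [simp]: "of_symbol 0 = 0"
  by (simp add: of_symbol_def)

lemma of_symbol_pCons [simp]: "of_symbol (pCons p P) = wpoly p + of_symbol P * wy"
proof -
  have "of_symbol (pCons p P) = (\<Sum>i\<le>Suc (degree P). wpoly (coeff (pCons p P) i) * wy ^ i)"
    by (rule of_symbol_upto) (simp add: degree_pCons_le)
  also have "\<dots> = wpoly p + (\<Sum>i\<le>degree P. wpoly (coeff P i) * wy ^ Suc i)"
    by (subst sum.atMost_Suc_shift) simp
  also have "(\<Sum>i\<le>degree P. wpoly (coeff P i) * wy ^ Suc i) = of_symbol P * wy"
    unfolding of_symbol_def sum_distrib_right
    by (intro sum.cong) (simp_all add: mult.assoc power_commutes)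
  finally show ?thesis .
qed

lemma of_symbol_add: "of_symbol (P + Q) = of_symbol P + of_symbol Q"
proof -
  let ?n = "max (degree P) (degree Q)"
  show ?thesis
    by (subst (1 2 3) of_symbol_upto[where n = ?n])
      (auto simp: degree_add_le_max sum.distrib wpoly_add ring_distribs)
qed

lemma of_symbol_minus: "of_symbol (- P) = - of_symbol P"
  using of_symbol_add[of P "- P"] by (simp add: eq_neg_iff_add_eq_0 add.commute)

lemma of_symbol_diff: "of_symbol (P - Q) = of_symbol P - of_symbol Q"
  using of_symbol_add[of P "- Q"] by (simp add: of_symbol_minus)

lemma of_symbol_smult: "of_symbol (smult p P) = wpoly p * of_symbol P"
  by (induction P) (simp_all add: wpoly_mult ring_distribs mult.assoc)

lemma of_symbol_monom: "of_symbol (monom p n) = wpoly p * wy ^ n"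
proof -
  have "of_symbol (monom p n) = (\<Sum>i\<le>n. wpoly (coeff (monom p n) i) * wy ^ i)"
    by (rule of_symbol_upto) (rule degree_monom_le)
  also have "\<dots> = (\<Sum>i\<le>n. if i = n then wpoly p * wy ^ n else 0)"
    by (intro sum.cong) auto
  finally show ?thesis by simp
qed

lemma wy_of_symbol: "wy * of_symbol P = of_symbol P * wy + of_symbol (map_poly pderiv P)"
proof (induction P)
  case (pCons p P)
  have "wy * of_symbol (pCons p P) = wy * wpoly p + (wy * of_symbol P) * wy"
    by (simp add: ring_distribs mult.assoc)
  also have "\<dots> = wpoly p * wy + wpoly (pderiv p)
      + (of_symbol P * wy + of_symbol (map_poly pderiv P)) * wy"
    by (simp only: wy_wpoly pCons)
  also have "\<dots> = of_symbol (pCons p P) * wy + of_symbol (map_poly pderiv (pCons p P))"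
    by (simp add: map_poly_pCons ring_distribs)
  finally show ?case .
qed simp

lemma of_symbol_wx: "of_symbol P * wx = wx * of_symbol P + of_symbol (pderiv P)"
proof (induction P)
  case (pCons p P)
  have "of_symbol (pCons p P) * wx = wpoly p * wx + of_symbol P * (wy * wx)"
    by (simp add: ring_distribs mult.assoc)
  also have "\<dots> = wpoly p * wx + (of_symbol P * wx) * wy + of_symbol P"
    by (simp add: wy_wx ring_distribs mult.assoc add.assoc)
  also have "\<dots> = wx * of_symbol (pCons p P) + of_symbol (pderiv (pCons p P))"
    by (simp add: pCons pderiv_pCons of_symbol_add ring_distribs
        wx_wpoly_commute mult.assoc add_ac)
  finally show ?case .
qed simp

text \<open>
  Left multiplication by a constant, \<open>x\<close> or \<open>y\<close> preserves normal order, hence so does left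
  multiplication by any expression in the generators; it remains to multiply \<open>1\<close>.
\<close>
lemma of_symbol_surj: "\<exists>P. a = of_symbol P"
proof -
  have left: "\<exists>Q. abs_weyl s * of_symbol P = of_symbol Q" for s P
  proof (induction s arbitrary: P)
    case (Cst c)
    have "abs_weyl (Cst c) = wpoly [:c:]"
      by (simp add: wconst.abs_eq)
    then show ?case by (metis of_symbol_smult)
  next
    case GenX
    have "abs_weyl GenX = wpoly [:0, 1:]"
      by (simp add: wx.abs_eq)
    then show ?case by (metis of_symbol_smult)
  next
    case GenY
    have "abs_weyl GenY * of_symbol P = of_symbol (pCons 0 P + map_poly pderiv P)"
      by (simp add: of_symbol_add wy_of_symbol flip: wy.abs_eq)
    then show ?case by metis
  next
    case (Add s t)
    have "abs_weyl (Add s t) = abs_weyl s + abs_weyl t"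
      by (simp add: plus_weyl.abs_eq)
    then show ?case by (metis Add semiring_class.distrib_right of_symbol_add)
  next
    case (Mul s t)
    have "abs_weyl (Mul s t) = abs_weyl s * abs_weyl t"
      by (simp add: times_weyl.abs_eq)
    then show ?case by (metis Mul mult.assoc)
  qed
  have "of_symbol 1 = 1"
    by (simp add: one_pCons)
  moreover obtain s where "a = abs_weyl s"
    using Quotient3_abs_rep[OF Quotient3_weyl, of a] by metis
  ultimately show ?thesis using left[of s 1] by (metis mult.right_neutral)
qed

section \<open>Operators on power series around a point\<close>

text \<open>
  The Weyl algebra acts on power series in \<open>t = x - c\<close> by differential operators. Unlike the
  polynomials, these contain the inverse of \<open>h\<close> when \<open>h\<close> does not vanish at \<open>c\<close>, and in
  characteristic 0 they are closed under antiderivatives.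
\<close>
primrec series_act :: "'f::field_char_0 \<Rightarrow> 'f wexp \<Rightarrow> 'f fps \<Rightarrow> 'f fps" where
  "series_act c (Cst a) \<psi> = fps_const a * \<psi>"
| "series_act c GenX \<psi> = fps_of_poly [:c, 1:] * \<psi>"
| "series_act c GenY \<psi> = fps_deriv \<psi>"
| "series_act c (Add s t) \<psi> = series_act c s \<psi> + series_act c t \<psi>"
| "series_act c (Mul s t) \<psi> = series_act c s (series_act c t \<psi>)"

lemma series_act_add: "series_act c s (\<phi> + \<psi>) = series_act c s \<phi> + series_act c s \<psi>"
  by (induction s arbitrary: \<phi> \<psi>) (simp_all add: algebra_simps)

lemma series_act_const_mult:
  "series_act c s (fps_const a * \<psi>) = fps_const a * series_act c s \<psi>"
  by (induction s arbitrary: \<psi>) (simp_all add: ring_distribs mult.left_commute)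

lift_definition series_op :: "'f::field_char_0 \<Rightarrow> 'f weyl \<Rightarrow> 'f fps \<Rightarrow> 'f fps" is series_act
proof
  fix c :: 'f and s t :: "'f wexp" and \<psi>
  assume "weyl_cong s t"
  then show "series_act c s \<psi> = series_act c t \<psi>"
  proof (induction arbitrary: \<psi> rule: weyl_cong.induct)
    case weyl_rel
    have "fps_deriv (fps_of_poly [:c, 1:]) = 1"
      by (simp add: fps_of_poly_pderiv[symmetric] pderiv_pCons)
    then show ?case by simp
  qed (simp_all add: series_act_add series_act_const_mult ring_distribs add_ac mult.assoc
      flip: fps_const_add fps_const_mult)
qed

lemma series_op_wconst [simp]: "series_op c (wconst a) \<psi> = fps_const a * \<psi>"
  and series_op_wx [simp]: "series_op c wx \<psi> = fps_of_poly [:c, 1:] * \<psi>"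
  and series_op_wy [simp]: "series_op c wy \<psi> = fps_deriv \<psi>"
  and series_op_plus [simp]: "series_op c (a' + b) \<psi> = series_op c a' \<psi> + series_op c b \<psi>"
  and series_op_times [simp]: "series_op c (a' * b) \<psi> = series_op c a' (series_op c b \<psi>)"
  and series_op_zero [simp]: "series_op c 0 \<psi> = 0"
  by (transfer; simp)+

lemma series_op_add: "series_op c a (\<phi> + \<psi>) = series_op c a \<phi> + series_op c a \<psi>"
  by transfer (rule series_act_add)

lemma series_op_diff: "series_op c a (\<phi> - \<psi>) = series_op c a \<phi> - series_op c a \<psi>"
  using series_op_add[of c a "\<phi> - \<psi>" \<psi>] by simp

lemma series_op_minus_left: "series_op c (a - b) \<psi> = series_op c a \<psi> - series_op c b \<psi>"
  using series_op_plus[of c "a - b" b \<psi>] by simp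

lemma series_op_wpoly: "series_op c (wpoly p) \<psi> = fps_of_poly (p \<circ>\<^sub>p [:c, 1:]) * \<psi>"
proof (induction p)
  case (pCons a p)
  have eq: "fps_of_poly (pCons a p \<circ>\<^sub>p [:c, 1:])
      = fps_const a + fps_of_poly [:c, 1:] * fps_of_poly (p \<circ>\<^sub>p [:c, 1:])"
    by (simp only: pcompose_pCons fps_of_poly_add fps_of_poly_mult fps_of_poly_const)
  show ?case
    unfolding eq using pCons by (simp add: ring_distribs mult.assoc)
qed simp

text \<open>
  If an operator acts as zero, so does its commutator with \<open>x\<close>, whose symbol has smaller degree in
  \<open>y\<close>. By induction the symbol is constant in \<open>y\<close>, and a multiplication operator is recovered from
  its value on the series \<open>1\<close>.
\<close>
lemma series_op_faithful_symbol:
  assumes "\<And>\<psi>. series_op c (of_symbol P) \<psi> = 0"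
  shows "P = 0"
  using assms
proof (induction "degree P" arbitrary: P rule: less_induct)
  case less
  have "of_symbol (pderiv P) = of_symbol P * wx - wx * of_symbol P"
    by (simp add: of_symbol_wx)
  then have zero: "series_op c (of_symbol (pderiv P)) \<psi> = 0" for \<psi>
    using less.prems by (simp add: series_op_minus_left)
  have "degree P = 0"
  proof (rule ccontr)
    assume "degree P \<noteq> 0"
    then have "pderiv P = 0"
      by (intro less.hyps[OF _ zero]) (simp add: degree_pderiv)
    with \<open>degree P \<noteq> 0\<close> show False by (simp add: pderiv_eq_0_iff)
  qed
  then obtain p where P: "P = [:p:]"
    by (rule degree_eq_zeroE)
  have "p \<circ>\<^sub>p [:c, 1:] = 0"
    using less.prems[of 1] by (simp add: P series_op_wpoly)
  then have "p = 0"
    by (rule pcompose_eq_0) simp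
  with P show ?case by simp
qed

lemma of_symbol_eq_0_iff [simp]: "of_symbol P = 0 \<longleftrightarrow> P = (0 :: 'f::field_char_0 poly poly)"
  using series_op_faithful_symbol[of 0 P] by auto

lemma of_symbol_eq_iff [simp]:
  "of_symbol P = of_symbol Q \<longleftrightarrow> P = (Q :: 'f::field_char_0 poly poly)"
  using of_symbol_eq_0_iff[of "P - Q"] by (simp add: of_symbol_diff del: of_symbol_eq_0_iff)

lemma wpoly_eq_iff [simp]: "wpoly p = wpoly q \<longleftrightarrow> p = (q :: 'f::field_char_0 poly)"
  using of_symbol_eq_iff[of "[:p:]" "[:q:]"] by simp

lemma series_op_faithful:
  assumes "\<And>\<psi>. series_op c a \<psi> = series_op c b \<psi>"
  shows "a = b"
proof -
  obtain P where "a - b = of_symbol P" using of_symbol_surj by blast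
  with assms series_op_faithful_symbol[of c P] have "a - b = 0"
    by (metis of_symbol_0 series_op_minus_left right_minus_eq)
  then show ?thesis by simp
qed

section \<open>The subalgebra in normal order\<close>

lemma commutator_add_left: "commutator (a + b) c = commutator a c + commutator b c"
  and commutator_add_right: "commutator a (b + c) = commutator a b + commutator a c"
  and commutator_minus_left: "commutator (a - b) c = commutator a c - commutator b c"
  and commutator_mult_right: "commutator a (b * c) = commutator a b * c + b * commutator a c"
  by (simp_all add: commutator_def algebra_simps)

lemma commutator_wconst_right [simp]: "commutator a (wconst c) = 0"
  by (simp add: commutator_def wconst_central)

lemma commutator_wpoly_wpoly [simp]: "commutator (wpoly p) (wpoly q) = 0"
  by (simp add: commutator_def wpoly_commute[of p q])

lemma commutator_wx: "commutator (of_symbol P) wx = of_symbol (pderiv P)"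
  by (simp add: commutator_def of_symbol_wx)

lemma commutator_wy: "commutator (of_symbol P) wy = - of_symbol (map_poly pderiv P)"
  by (simp add: commutator_def wy_of_symbol)

text \<open>
  For \<open>j = 0\<close> this describes the symbols of the elements of \<open>A\<^sub>h\<close>. The shift \<open>j\<close> records the
  additional divisibility gained by differentiating in \<open>y\<close>, and lost by multiplying with \<open>y\<close>.
\<close>
definition adapted :: "'f::field poly \<Rightarrow> nat \<Rightarrow> 'f poly poly \<Rightarrow> bool" where
  "adapted h j P \<longleftrightarrow> (\<forall>n. h ^ (n + j) dvd coeff P n)"

lemma adapted_0 [simp]: "adapted h j 0"
  by (simp add: adapted_def)

lemma adapted_add: "adapted h j P \<Longrightarrow> adapted h j Q \<Longrightarrow> adapted h j (P + Q)"
  by (simp add: adapted_def)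

lemma adapted_smult: "adapted h j P \<Longrightarrow> adapted h j (smult p P)"
  by (simp add: adapted_def)

lemma adapted_Suc: "adapted h (Suc j) P \<Longrightarrow> adapted h j P"
  unfolding adapted_def by (metis add_Suc_right dvd_trans le_SucI le_imp_power_dvd order_refl)

lemma adapted_pCons_0: "adapted h (Suc j) P \<Longrightarrow> adapted h j (pCons 0 P)"
  by (auto simp: adapted_def coeff_pCons split: nat.split)

lemma dvd_of_nat_mult_iff:
  fixes p q :: "'f::field_char_0 poly"
  shows "q dvd of_nat (Suc n) * p \<longleftrightarrow> q dvd p"
proof -
  have "of_nat (Suc n) * p = smult (of_nat (Suc n)) p"
    by (simp only: of_nat_poly mult_pCons_left) simp
  then show ?thesis
    by (metis dvd_smult_iff of_nat_neq_0)
qed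

lemma adapted_pderiv_iff:
  fixes h :: "'f::field_char_0 poly"
  shows "adapted h j (pderiv P) \<longleftrightarrow> (\<forall>n. h ^ (n + j) dvd coeff P (Suc n))"
  by (simp only: adapted_def coeff_pderiv dvd_of_nat_mult_iff)

lemma adapted_pderiv:
  fixes h :: "'f::field_char_0 poly"
  assumes "adapted h j P" shows "adapted h (Suc j) (pderiv P)"
  using assms unfolding adapted_pderiv_iff by (simp add: adapted_def) (metis add_Suc power_Suc)

lemma mult_pderiv_power:
  fixes h :: "'f::field poly"
  shows "h * pderiv (h ^ n) = of_nat n * (h ^ n * pderiv h)"
proof (induction n)
  case (Suc n)
  have "h * pderiv (h ^ Suc n) = h * (h * pderiv (h ^ n)) + h ^ Suc n * pderiv h"
    by (simp add: pderiv_mult ring_distribs mult_ac)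
  also have "\<dots> = of_nat (Suc n) * (h ^ Suc n * pderiv h)"
    unfolding Suc by (simp add: ring_distribs mult_ac)
  finally show ?case .
qed simp

lemma power_dvd_pderiv: "h ^ Suc n dvd p \<Longrightarrow> h ^ n dvd pderiv (p :: 'f::field poly)"
proof (elim dvdE)
  fix q assume "p = h ^ Suc n * q"
  then have "pderiv p = h ^ n * (pderiv h * q + h * pderiv q) + h * pderiv (h ^ n) * q"
    by (simp add: pderiv_mult algebra_simps)
  then show ?thesis
    by (simp add: mult_pderiv_power dvd_add)
qed

lemma Ah_zero: "0 \<in> Ah h"
  using Ah.const[of 0 h] by simp

lemma Ah_minus: "a \<in> Ah h \<Longrightarrow> - a \<in> Ah h"
  using Ah.mult[OF Ah.const[of "-1"], of a h] by (simp add: wconst_minus)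

lemma Ah_diff: "a \<in> Ah h \<Longrightarrow> b \<in> Ah h \<Longrightarrow> a - b \<in> Ah h"
  using Ah.add[of a h "- b"] Ah_minus by force

lemma Ah_sum: "(\<And>i. i \<in> I \<Longrightarrow> f i \<in> Ah h) \<Longrightarrow> sum f I \<in> Ah h"
  by (induction I rule: infinite_finite_induct) (auto intro: Ah_zero Ah.add)

lemma Ah_wpoly: "wpoly p \<in> Ah h"
  by (induction p) (auto intro: Ah_zero Ah.intros)

lemma Ah_scale: "a \<in> Ah h \<Longrightarrow> wscale c a \<in> Ah h"
  unfolding wscale_def by (intro Ah.mult Ah.const)

text \<open>
  Multiplying \<open>h\<^sup>n q y\<^sup>n\<close> on the left by \<open>yh\<close> gives \<open>h\<^sup>n\<^sup>+\<^sup>1 q y\<^sup>n\<^sup>+\<^sup>1\<close> plus a term of lower order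
  whose coefficient, a derivative, is still divisible by \<open>h\<^sup>n\<close>.
\<close>
lemma Ah_monomial: "h ^ n dvd p \<Longrightarrow> wpoly p * wy ^ n \<in> Ah h"
proof (induction n arbitrary: p)
  case (Suc n)
  then obtain q where p: "p = h * (h ^ n * q)"
    by (metis dvdE mult.assoc power_Suc)
  have "yhat h * (wpoly (h ^ n * q) * wy ^ n) = wy * wpoly p * wy ^ n"
    by (simp add: yhat_def p wpoly_mult mult.assoc)
  also have "\<dots> = wpoly p * wy ^ Suc n + wpoly (pderiv p) * wy ^ n"
    by (simp add: wy_wpoly ring_distribs mult.assoc)
  finally have "wpoly p * wy ^ Suc n
      = yhat h * (wpoly (h ^ n * q) * wy ^ n) - wpoly (pderiv p) * wy ^ n"
    by simp
  moreover have "yhat h * (wpoly (h ^ n * q) * wy ^ n) \<in> Ah h"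
    by (intro Ah.mult Ah.yhat Suc.IH) simp
  moreover have "wpoly (pderiv p) * wy ^ n \<in> Ah h"
    using Suc.prems by (intro Suc.IH power_dvd_pderiv)
  ultimately show ?case by (simp add: Ah_diff)
qed (simp add: Ah_wpoly)

lemma yhat_mult_symbol:
  "yhat h * of_symbol P = of_symbol (pCons 0 (smult h P) + map_poly pderiv (smult h P))"
  by (simp add: yhat_def mult.assoc of_symbol_add wy_of_symbol flip: of_symbol_smult)

text \<open>
  Closure of the operators with adapted symbol under products would require normal ordering an
  arbitrary product. It suffices that they are stable under left multiplication by the
  generators, since they contain \<open>1\<close>.
\<close>
lemma Ah_left_mult_adapted:
  "a \<in> Ah h \<Longrightarrow> adapted h 0 P \<Longrightarrow> \<exists>Q. adapted h 0 Q \<and> a * of_symbol P = of_symbol Q"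
proof (induction arbitrary: P rule: Ah.induct)
  case (const c)
  then show ?case by (metis adapted_smult of_symbol_smult wpoly_const)
next
  case x
  then show ?case by (metis adapted_smult of_symbol_smult wx_eq_wpoly)
next
  case yhat
  have "h ^ Suc n dvd coeff (smult h P) n" for n
    using yhat by (simp add: adapted_def)
  then have "adapted h 0 (pCons 0 (smult h P) + map_poly pderiv (smult h P))"
    by (intro adapted_add adapted_pCons_0)
      (auto simp: adapted_def coeff_map_poly simp del: power_Suc coeff_smult
        intro: power_dvd_pderiv)
  then show ?case by (metis yhat_mult_symbol)
next
  case (add a b)
  then show ?case by (metis adapted_add of_symbol_add semiring_class.distrib_right)
next
  case (mult a b)
  then show ?case by (metis mult.assoc)
qed

lemma of_symbol_in_Ah_iff:
  fixes h :: "'f::field_char_0 poly"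
  shows "of_symbol P \<in> Ah h \<longleftrightarrow> adapted h 0 P"
proof
  assume "of_symbol P \<in> Ah h"
  moreover have "adapted h 0 1" "of_symbol 1 = (1 :: 'f weyl)"
    by (auto simp: adapted_def one_pCons coeff_pCons split: nat.split)
  ultimately obtain Q where "adapted h 0 Q" "of_symbol P = of_symbol Q"
    using Ah_left_mult_adapted by (metis mult_1_right)
  then show "adapted h 0 P" by simp
next
  assume "adapted h 0 P"
  then show "of_symbol P \<in> Ah h"
    unfolding of_symbol_def by (intro Ah_sum Ah_monomial) (simp add: adapted_def)
qed

section \<open>The normalizer in normal order\<close>

text \<open>
  The symbol of \<open>[u, p]\<close> is \<open>\<Sum> p\<^sup>(\<^sup>k\<^sup>) \<partial>\<^sup>kP / k!\<close> over \<open>k \<ge> 1\<close>, where \<open>P\<close> is the symbol of \<open>u\<close> and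
  \<open>\<partial>\<close> differentiates in \<open>y\<close>. Only two consequences of this Taylor formula are needed: it is as
  adapted as \<open>\<partial>P\<close>, and its terms with \<open>k \<ge> 2\<close> are better by one step. Both follow by induction on
  \<open>p\<close> from \<open>[u, x p] = [u, x] p + x [u, p]\<close>.
\<close>
lemma commutator_wpoly_adapted:
  fixes h :: "'f::field_char_0 poly"
  assumes "adapted h j (pderiv P)"
  shows "\<exists>Q. adapted h j Q \<and> commutator (of_symbol P) (wpoly p) = of_symbol Q"
  using assms
proof (induction p arbitrary: P)
  case 0
  show ?case by (intro exI[of _ 0]) (simp add: commutator_def)
next
  case (pCons c p)
  obtain Q1 where Q1: "adapted h j Q1" "commutator (of_symbol P) (wpoly p) = of_symbol Q1"
    using pCons by blast
  obtain Q2 where Q2: "adapted h j Q2" "commutator (of_symbol (pderiv P)) (wpoly p) = of_symbol Q2"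
    using pCons.IH[OF adapted_Suc[OF adapted_pderiv[OF pCons.prems]]] by blast
  have expand: "commutator (of_symbol P) (wpoly (pCons c p))
      = of_symbol (pderiv P) * wpoly p + wx * commutator (of_symbol P) (wpoly p)"
    by (simp add: commutator_add_right commutator_mult_right commutator_wx)
  have swap: "of_symbol (pderiv P) * wpoly p
      = wpoly p * of_symbol (pderiv P) + commutator (of_symbol (pderiv P)) (wpoly p)"
    by (simp add: commutator_def)
  have "commutator (of_symbol P) (wpoly (pCons c p))
      = of_symbol (smult p (pderiv P) + Q2 + smult [:0, 1:] Q1)"
    by (simp only: expand swap Q1 Q2 of_symbol_add of_symbol_smult wx_eq_wpoly)
  then show ?case
    using pCons.prems Q1(1) Q2(1)
    by (intro exI[of _ "smult p (pderiv P) + Q2 + smult [:0, 1:] Q1"] conjI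
        adapted_add adapted_smult)
qed

lemma commutator_wpoly_leading:
  fixes h :: "'f::field_char_0 poly"
  assumes "adapted h j (pderiv P)"
  shows "\<exists>Q. adapted h (Suc j) Q \<and>
    commutator (of_symbol P) (wpoly p) = of_symbol (smult (pderiv p) (pderiv P) + Q)"
proof (induction p)
  case 0
  show ?case by (intro exI[of _ 0]) (simp add: commutator_def)
next
  case (pCons c p)
  obtain Q1 where Q1: "adapted h (Suc j) Q1"
      "commutator (of_symbol P) (wpoly p) = of_symbol (smult (pderiv p) (pderiv P) + Q1)"
    using pCons by blast
  obtain Q2 where Q2: "adapted h (Suc j) Q2"
      "commutator (of_symbol (pderiv P)) (wpoly p) = of_symbol Q2"
    using commutator_wpoly_adapted[OF adapted_pderiv[OF assms]] by blast
  have expand: "commutator (of_symbol P) (wpoly (pCons c p))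
      = of_symbol (pderiv P) * wpoly p + wx * commutator (of_symbol P) (wpoly p)"
    by (simp add: commutator_add_right commutator_mult_right commutator_wx)
  have swap: "of_symbol (pderiv P) * wpoly p
      = wpoly p * of_symbol (pderiv P) + commutator (of_symbol (pderiv P)) (wpoly p)"
    by (simp add: commutator_def)
  have "commutator (of_symbol P) (wpoly (pCons c p)) = of_symbol (smult p (pderiv P) + Q2
      + smult [:0, 1:] (smult (pderiv p) (pderiv P) + Q1))"
    by (simp only: expand swap Q1 Q2 of_symbol_add of_symbol_smult wx_eq_wpoly)
  also have "smult p (pderiv P) + Q2 + smult [:0, 1:] (smult (pderiv p) (pderiv P) + Q1)
      = smult (pderiv (pCons c p)) (pderiv P) + (Q2 + smult [:0, 1:] Q1)"
    by (simp add: pderiv_pCons smult_add_left smult_add_right algebra_simps)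
  finally show ?case
    using Q1(1) Q2(1)
    by (intro exI[of _ "Q2 + smult [:0, 1:] Q1"] conjI
        adapted_add adapted_smult)
qed

lemma monic_dvd_antisym:
  fixes p q :: "'f::field poly"
  assumes "lead_coeff p = 1" "lead_coeff q = 1" "p dvd q" "q dvd p"
  shows "p = q"
proof -
  have nz: "p \<noteq> 0" "q \<noteq> 0" using assms by auto
  obtain k where k: "q = p * k" using \<open>p dvd q\<close> by auto
  have "degree q \<le> degree p" using assms nz by (intro dvd_imp_degree_le)
  with k nz have "degree k = 0" by (simp add: degree_mult_eq)
  then obtain a where a: "k = [:a:]" by (rule degree_eq_zeroE)
  have "lead_coeff q = lead_coeff p * lead_coeff k" by (simp only: k lead_coeff_mult)
  with a assms(1,2) have "k = 1" by (simp add: one_pCons)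
  with k show ?thesis by simp
qed

text \<open>
  The polynomials \<open>r\<close> with \<open>h dvd h' r\<close> form an ideal containing \<open>h\<close>; it is generated by any
  nonzero element of least degree, which division with remainder shows.
\<close>
lemma pi_poly_spec:
  assumes "h \<noteq> (0 :: 'f::field poly)"
  shows "lead_coeff (pi_poly h) = 1" "h dvd pderiv h * r \<longleftrightarrow> pi_poly h dvd r"
proof -
  define I where "I = {r. h dvd pderiv h * r}"
  have "h \<in> I" by (simp add: I_def)
  define p where "p = arg_min degree (\<lambda>r. r \<in> I \<and> r \<noteq> 0)"
  have p: "p \<in> I" "p \<noteq> 0" and p_min: "\<And>r. r \<in> I \<Longrightarrow> r \<noteq> 0 \<Longrightarrow> degree p \<le> degree r"
    using arg_min_nat_lemma[of "\<lambda>r. r \<in> I \<and> r \<noteq> 0" h degree] \<open>h \<in> I\<close> assms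
    by (auto simp: p_def)
  have gen: "r \<in> I \<longleftrightarrow> p dvd r" for r
  proof
    assume "r \<in> I"
    have "r mod p = r - p * (r div p)"
      by (simp add: minus_mult_div_eq_mod)
    then have "pderiv h * (r mod p) = pderiv h * r - pderiv h * p * (r div p)"
      by (simp only: right_diff_distrib mult.assoc)
    moreover have "h dvd pderiv h * r" "h dvd pderiv h * p * (r div p)"
      using \<open>r \<in> I\<close> p by (simp_all add: I_def)
    ultimately have "r mod p \<in> I"
      unfolding I_def by (simp only: mem_Collect_eq dvd_diff)
    with p_min[of "r mod p"] degree_mod_less[OF p(2), of r] have "r mod p = 0"
      by linarith
    then show "p dvd r" by (simp add: dvd_eq_mod_eq_0)
  next
    assume "p dvd r"
    then have "pderiv h * p dvd pderiv h * r" by (rule mult_dvd_mono[OF dvd_refl])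
    moreover have "h dvd pderiv h * p" using p by (simp add: I_def)
    ultimately show "r \<in> I"
      unfolding I_def using dvd_trans by blast
  qed
  define q where "q = smult (inverse (lead_coeff p)) p"
  have "lead_coeff q = 1" "\<forall>r. h dvd pderiv h * r \<longleftrightarrow> q dvd r"
    using p gen by (auto simp: q_def I_def smult_dvd_iff)
  moreover have "p1 = p2" if "lead_coeff p1 = 1" "\<forall>r. h dvd pderiv h * r \<longleftrightarrow> p1 dvd r"
    "lead_coeff p2 = 1" "\<forall>r. h dvd pderiv h * r \<longleftrightarrow> p2 dvd r" for p1 p2 :: "'f poly"
    using that by (metis monic_dvd_antisym dvd_refl)
  ultimately have "\<exists>!p. lead_coeff p = 1 \<and> (\<forall>r. h dvd pderiv h * r \<longleftrightarrow> p dvd r)"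
    by (intro ex1I[of _ q]) simp_all
  from theI'[OF this]
  show "lead_coeff (pi_poly h) = 1" "h dvd pderiv h * r \<longleftrightarrow> pi_poly h dvd r"
    unfolding pi_poly_def by blast+
qed

lemma pi_poly_nonzero: "h \<noteq> 0 \<Longrightarrow> pi_poly h \<noteq> 0"
  using pi_poly_spec(1) by force

lemma pi_poly_dvd: "h \<noteq> 0 \<Longrightarrow> pi_poly h dvd h"
  using pi_poly_spec(2)[of h h] by simp

lemma div_pi_poly: "h \<noteq> 0 \<Longrightarrow> h div pi_poly h * pi_poly h = h"
  by (simp add: pi_poly_dvd)

lemma div_pi_poly_nonzero: "h \<noteq> 0 \<Longrightarrow> h div pi_poly h \<noteq> 0"
  using div_pi_poly by force

lemma normalizer_iff_generators:
  "u \<in> normalizer h \<longleftrightarrow> commutator u wx \<in> Ah h \<and> commutator u (yhat h) \<in> Ah h"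
proof
  assume "u \<in> normalizer h"
  then show "commutator u wx \<in> Ah h \<and> commutator u (yhat h) \<in> Ah h"
    by (auto simp: normalizer_def intro: Ah.intros)
next
  assume gens: "commutator u wx \<in> Ah h \<and> commutator u (yhat h) \<in> Ah h"
  have "commutator u v \<in> Ah h" if "v \<in> Ah h" for v
    using that
  proof induction
    case (mult a b)
    then show ?case
      unfolding commutator_mult_right by (intro Ah.add Ah.mult)
  qed (use gens in \<open>auto simp: commutator_add_right intro: Ah_zero Ah.intros\<close>)
  then show "u \<in> normalizer h"
    by (simp add: normalizer_def)
qed

text \<open>
  For \<open>p = q h\<^sup>n\<close> the expression is \<open>q h' h\<^sup>n - q' h\<^sup>n\<^sup>+\<^sup>1\<close>. It is the part of the commutator of
  \<open>p y\<^sup>n\<^sup>+\<^sup>1\<close> with \<open>yh\<close> that may fail to lie in \<open>A\<^sub>h\<close>.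
\<close>
lemma power_dvd_bracket_iff:
  fixes h :: "'f::field_char_0 poly"
  assumes "h \<noteq> 0" "h ^ n dvd p"
  shows "h ^ Suc n dvd pderiv h * (of_nat (Suc n) * p) - h * pderiv p
    \<longleftrightarrow> pi_poly h * h ^ n dvd p"
proof -
  obtain q where p: "p = h ^ n * q" using assms(2) by auto
  have "h * pderiv (h ^ n) = of_nat n * h ^ n * pderiv h"
    by (simp add: mult_pderiv_power mult.assoc)
  then have "pderiv h * (of_nat (Suc n) * p) - h * pderiv p
      = h ^ n * (pderiv h * q) - h ^ Suc n * pderiv q"
    by (simp add: p pderiv_mult algebra_simps)
  then have "h ^ Suc n dvd pderiv h * (of_nat (Suc n) * p) - h * pderiv p
      \<longleftrightarrow> h ^ Suc n dvd h ^ n * (pderiv h * q)"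
    by (simp only: dvd_diff_left_iff dvd_triv_left)
  also have "\<dots> \<longleftrightarrow> pi_poly h dvd q"
    using assms pi_poly_spec(2)[of h q] by (simp only: power_Suc2 dvd_mult_cancel_left) simp
  also have "\<dots> \<longleftrightarrow> pi_poly h * h ^ n dvd p"
    using assms by (simp add: p mult.commute)
  finally show ?thesis .
qed

text \<open>
  With \<open>yh = hy + h'\<close>, the commutator \<open>[u, yh]\<close> is \<open>[u, h] y + h [u, y] + [u, h']\<close>. When \<open>[u, x]\<close> is
  in \<open>A\<^sub>h\<close>, all terms are in \<open>A\<^sub>h\<close> except for \<open>h [u, y]\<close> and the first-order part of \<open>[u, h] y\<close>,
  which have to be taken together.
\<close>
lemma of_symbol_in_normalizer_iff:
  fixes h :: "'f::field_char_0 poly"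
  assumes "h \<noteq> 0"
  shows "of_symbol P \<in> normalizer h \<longleftrightarrow> (\<forall>n. pi_poly h * h ^ n dvd coeff P (Suc n))"
proof (cases "adapted h 0 (pderiv P)")
  case False
  then obtain n where "\<not> h ^ n dvd coeff P (Suc n)"
    unfolding adapted_pderiv_iff by auto
  then have "\<not> pi_poly h * h ^ n dvd coeff P (Suc n)"
    by (meson dvd_mult_right)
  with False show ?thesis
    by (auto simp: normalizer_iff_generators commutator_wx of_symbol_in_Ah_iff)
next
  case True
  obtain Q1 where Q1: "adapted h 1 Q1"
      "commutator (of_symbol P) (wpoly h) = of_symbol (smult (pderiv h) (pderiv P) + Q1)"
    using commutator_wpoly_leading[OF True] by auto
  obtain Q2 where Q2: "adapted h 0 Q2"
      "commutator (of_symbol P) (wpoly (pderiv h)) = of_symbol Q2"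
    using commutator_wpoly_adapted[OF True] by blast
  (* M collects the two terms that need not be adapted by themselves, E the harmless rest. *)
  define M where "M = pCons 0 (smult (pderiv h) (pderiv P)) - smult h (map_poly pderiv P)"
  define E where "E = pCons 0 Q1 + Q2"
  have "adapted h 0 E"
    using Q1 Q2 by (auto simp: E_def intro: adapted_add adapted_pCons_0)
  have "commutator (of_symbol P) (yhat h)
      = commutator (of_symbol P) (wpoly h) * wy + wpoly h * commutator (of_symbol P) wy
        + commutator (of_symbol P) (wpoly (pderiv h))"
    by (simp add: yhat_def wy_wpoly commutator_add_right commutator_mult_right)
  also have "\<dots> = of_symbol (M + E)"
    by (simp add: Q1 Q2 commutator_wy M_def E_def of_symbol_add of_symbol_diff of_symbol_smult
        ring_distribs)
  finally have "commutator (of_symbol P) (yhat h) \<in> Ah h \<longleftrightarrow> of_symbol (M + E) \<in> Ah h"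
    by simp
  also have "\<dots> \<longleftrightarrow> adapted h 0 M"
    using \<open>adapted h 0 E\<close> unfolding of_symbol_in_Ah_iff
    by (simp add: adapted_def dvd_add_left_iff)
  also have "\<dots> \<longleftrightarrow> (\<forall>n. h ^ Suc n dvd coeff M (Suc n))"
    unfolding adapted_def proof (intro iffI allI)
    fix n assume "\<forall>n. h ^ Suc n dvd coeff M (Suc n)"
    then show "h ^ (n + 0) dvd coeff M n" by (cases n) simp_all
  qed (metis add_0_right)
  also have "\<dots> \<longleftrightarrow> (\<forall>n. pi_poly h * h ^ n dvd coeff P (Suc n))"
  proof -
    have "h ^ n dvd coeff P (Suc n)" for n
      using True by (simp add: adapted_pderiv_iff)
    then have "h ^ Suc n dvd coeff M (Suc n) \<longleftrightarrow> pi_poly h * h ^ n dvd coeff P (Suc n)" for n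
      using power_dvd_bracket_iff[OF assms, of n "coeff P (Suc n)"]
      by (simp add: M_def coeff_pderiv coeff_map_poly del: power_Suc of_nat_Suc)
    then show ?thesis by simp
  qed
  finally show ?thesis
    using True by (auto simp: normalizer_iff_generators commutator_wx of_symbol_in_Ah_iff)
qed

section \<open>Derivations of the subalgebra\<close>

lemma DerI:
  assumes "\<And>a. a \<in> Ah h \<Longrightarrow> d a \<in> Ah h"
    and "\<And>a b. a \<in> Ah h \<Longrightarrow> b \<in> Ah h \<Longrightarrow> d (a + b) = d a + d b"
    and "\<And>c a. a \<in> Ah h \<Longrightarrow> d (wscale c a) = wscale c (d a)"
    and "\<And>a b. a \<in> Ah h \<Longrightarrow> b \<in> Ah h \<Longrightarrow> d (a * b) = d a * b + a * d b"
    and "\<And>a. a \<notin> Ah h \<Longrightarrow> d a = 0"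
  shows "d \<in> Der h"
  using assms by (simp add: Der_def)

lemma DerD:
  assumes "d \<in> Der h"
  shows "a \<in> Ah h \<Longrightarrow> d a \<in> Ah h"
    and "a \<in> Ah h \<Longrightarrow> b \<in> Ah h \<Longrightarrow> d (a + b) = d a + d b"
    and "a \<in> Ah h \<Longrightarrow> d (wscale c a) = wscale c (d a)"
    and "a \<in> Ah h \<Longrightarrow> b \<in> Ah h \<Longrightarrow> d (a * b) = d a * b + a * d b"
    and "a \<notin> Ah h \<Longrightarrow> d a = 0"
  using assms by (simp_all add: Der_def)

lemma Der_wconst:
  assumes "d \<in> Der h" shows "d (wconst c) = 0"
proof -
  have one: "1 \<in> Ah h" using Ah.const[of 1 h] by simp
  then have "d 1 = 0" using DerD(4)[OF assms, of 1 1] by simp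
  then show ?thesis using DerD(3)[OF assms one, of c] by (simp add: wscale_def)
qed

lemma Der_eqI:
  assumes d: "d \<in> Der h" and e: "e \<in> Der h"
    and gens: "d wx = e wx" "d (yhat h) = e (yhat h)"
  shows "d = e"
proof
  fix a
  have "d a = e a" if "a \<in> Ah h"
    using that
    by induction
      (simp_all add: gens Der_wconst[OF d] Der_wconst[OF e] DerD(2,4)[OF d] DerD(2,4)[OF e])
  then show "d a = e a" using DerD(5)[OF d] DerD(5)[OF e] by metis
qed

global_interpretation weyl: vector_space wscale
  by unfold_locales (simp_all add: wscale_def wconst_add wconst_mult algebra_simps)

lemma wscale_mult_right: "a * wscale c b = wscale c (a * b)"
  unfolding wscale_def by (metis mult.assoc wconst_central)

lemma wscale_mult_left: "wscale c a * b = wscale c (a * b)"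
  by (simp add: wscale_def mult.assoc)

lemma subspace_Der: "maps.subspace (Der h)"
proof (rule maps.subspaceI)
  show "0 \<in> Der h"
    by (rule DerI) (simp_all add: Ah_zero wscale_def)
next
  fix d e assume "d \<in> Der h" "e \<in> Der h"
  then show "d + e \<in> Der h"
    by (intro DerI) (simp_all add: DerD Ah.add weyl.scale_right_distrib algebra_simps)
next
  fix c d assume d: "d \<in> Der h"
  then show "fscale c d \<in> Der h"
    by (intro DerI) (simp_all add: DerD Ah_scale fscale_def weyl.scale_right_distrib
        weyl.scale_left_commute wscale_mult_left wscale_mult_right)
qed

lemma commutator_scale_left: "commutator (wscale c a) b = wscale c (commutator a b)"
  and commutator_scale_right: "commutator a (wscale c b) = wscale c (commutator a b)"
  by (simp_all add: commutator_def wscale_mult_left wscale_mult_right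
      weyl.scale_right_diff_distrib)

lemma subspace_Ah: "weyl.subspace (Ah h)"
  by (rule weyl.subspaceI) (auto intro: Ah_zero Ah.add Ah_scale)

lemma subspace_normalizer: "weyl.subspace (normalizer h)"
  by (rule weyl.subspaceI)
    (auto simp: normalizer_def commutator_add_left commutator_scale_left commutator_def[of 0]
      intro: Ah_zero Ah.add Ah_scale)

lemma Ah_subset_normalizer: "Ah h \<subseteq> normalizer h"
  by (auto simp: normalizer_def commutator_def intro: Ah_diff Ah.mult)

lemma ad_hom: "module_hom wscale fscale (ad h)"
  by (intro module_hom.intro weyl.module_axioms maps.module_axioms module_hom_axioms.intro)
    (auto simp: ad_def fun_eq_iff commutator_add_left commutator_scale_left fscale_def)

lemma ad_add: "ad h (u + v) = ad h u + ad h v"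
  using module_hom.add[OF ad_hom] .

lemma ad_in_Der: "u \<in> normalizer h \<Longrightarrow> ad h u \<in> Der h"
  by (intro DerI) (auto simp: ad_def normalizer_def commutator_add_right commutator_scale_right
      commutator_mult_right Ah.add Ah.mult Ah_scale)

lemma ad_wx: "ad h u wx = commutator u wx"
  and ad_yhat: "ad h u (yhat h) = commutator u (yhat h)"
  by (simp_all add: ad_def Ah.x Ah.yhat)

lemma commutator_wpoly_yhat: "commutator (wpoly p) (yhat h) = - wpoly (h * pderiv p)"
proof -
  have "commutator (wpoly p) (yhat h) = (wpoly p * wy - wy * wpoly p) * wpoly h"
    by (simp add: commutator_def yhat_def algebra_simps wpoly_commute[of h p])
  then show ?thesis
    by (simp add: wy_wpoly wpoly_mult wpoly_commute[of h])
qed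

lemma centralizer_wx:
  fixes u :: "'f::field_char_0 weyl"
  assumes "commutator u wx = 0"
  shows "\<exists>p. u = wpoly p"
proof -
  obtain P where u: "u = of_symbol P" using of_symbol_surj by blast
  with assms have "pderiv P = 0" by (simp add: commutator_wx)
  then obtain p where "P = [:p:]" by (auto simp: pderiv_eq_0_iff elim: degree_eq_zeroE)
  with u show ?thesis by auto
qed

text \<open>
  Coefficients are taken in a domain where positive integers divide, because antiderivatives are
  needed both for polynomials in \<open>x\<close> and, in the variable \<open>y\<close>, for symbols.
\<close>
lemma antiderivative_exists:
  fixes Q :: "'a::idom poly"
  assumes "\<And>n (q::'a). \<exists>r. of_nat (Suc n) * r = q"
  shows "\<exists>P. pderiv P = Q"
proof -
  have "\<exists>P. pderiv P = (\<Sum>i\<le>n. monom (coeff Q i) i)" for n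
  proof (induction n)
    case 0
    show ?case by (intro exI[of _ "monom (coeff Q 0) 1"]) (simp add: pderiv_monom)
  next
    case (Suc n)
    then obtain P where "pderiv P = (\<Sum>i\<le>n. monom (coeff Q i) i)" by blast
    moreover obtain r where "of_nat (Suc (Suc n)) * r = coeff Q (Suc n)" using assms by blast
    ultimately have "pderiv (P + monom r (Suc (Suc n))) = (\<Sum>i\<le>Suc n. monom (coeff Q i) i)"
      by (simp add: pderiv_add pderiv_monom del: of_nat_Suc)
    then show ?case by blast
  qed
  then show ?thesis using poly_as_sum_of_monoms by metis
qed

lemma poly_antiderivative:
  fixes q :: "'f::field_char_0 poly"
  shows "\<exists>p. pderiv p = q"
proof (rule antiderivative_exists)
  fix n and a :: 'f
  show "\<exists>r. of_nat (Suc n) * r = a"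
    by (intro exI[of _ "a / of_nat (Suc n)"]) (simp del: of_nat_Suc)
qed

lemma symbol_antiderivative:
  fixes Q :: "'f::field_char_0 poly poly"
  shows "\<exists>P. pderiv P = Q"
proof (rule antiderivative_exists)
  fix n and q :: "'f poly"
  show "\<exists>r. of_nat (Suc n) * r = q"
    by (intro exI[of _ "smult (inverse (of_nat (Suc n))) q"])
      (simp add: of_nat_poly del: of_nat_Suc)
qed

text \<open>
  As an operator on power series around a point where \<open>h\<close> does not vanish, \<open>a f - f a\<close> with
  \<open>f' = g / h\<close> is a derivation of \<open>a\<close> that sends \<open>x\<close> to \<open>0\<close> and \<open>yh\<close> to \<open>f' h = g\<close>. Its values at the
  generators of \<open>A\<^sub>h\<close> are operators from \<open>A\<^sub>h\<close>, hence so are its values on all of \<open>A\<^sub>h\<close> by the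
  product rule, and by faithfulness it is a derivation of the abstract algebra.
\<close>
lemma D_exists:
  fixes h :: "'f::field_char_0 poly"
  assumes "h \<noteq> 0"
  shows "\<exists>d \<in> Der h. d wx = 0 \<and> d (yhat h) = wpoly g"
proof -
  have "finite {c. poly h c = 0}" using assms by (rule poly_roots_finite)
  then obtain c where c: "poly h c \<noteq> 0"
    using infinite_UNIV_char_0[where ?'a = 'f]
    by (metis (mono_tags, lifting) UNIV_eq_I mem_Collect_eq)
  define H where "H = fps_of_poly (h \<circ>\<^sub>p [:c, 1:])"
  define G where "G = fps_of_poly (g \<circ>\<^sub>p [:c, 1:])"
  define f where "f = fps_integral0 (G * inverse H)"
  have "fps_nth H 0 \<noteq> 0"
    using c by (simp add: H_def poly_pcompose flip: poly_0_coeff_0)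
  then have f: "fps_deriv f * H = G"
    by (simp add: f_def fps_deriv_fps_integral mult.assoc inverse_mult_eq_1)
  define T where "T a \<psi> = series_op c a (f * \<psi>) - f * series_op c a \<psi>" for a \<psi>
  have T_mult: "T (a * b) \<psi> = T a (series_op c b \<psi>) + series_op c a (T b \<psi>)" for a b \<psi>
    by (simp add: T_def series_op_diff)
  have T_yhat: "T (yhat h) \<psi> = G * \<psi>" for \<psi>
    unfolding f[symmetric] T_def yhat_def H_def
    by (simp add: series_op_wpoly algebra_simps)
  have "\<exists>b \<in> Ah h. \<forall>\<psi>. series_op c b \<psi> = T a \<psi>" if "a \<in> Ah h" for a
    using that
  proof induction
    case (const k)
    show ?case by (intro bexI[of _ 0]) (auto simp: T_def mult.left_commute intro: Ah_zero)
  next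
    case x
    show ?case by (intro bexI[of _ 0]) (auto simp: T_def mult.left_commute intro: Ah_zero)
  next
    case yhat
    show ?case
      by (intro bexI[of _ "wpoly g"]) (auto simp: T_yhat series_op_wpoly G_def intro: Ah_wpoly)
  next
    case (add a b)
    then obtain a' b' where "a' \<in> Ah h" "\<forall>\<psi>. series_op c a' \<psi> = T a \<psi>"
      "b' \<in> Ah h" "\<forall>\<psi>. series_op c b' \<psi> = T b \<psi>" by blast
    then show ?case
      by (intro bexI[of _ "a' + b'"]) (auto simp: T_def ring_distribs intro: Ah.add)
  next
    case (mult a b)
    then obtain a' b' where "a' \<in> Ah h" "\<forall>\<psi>. series_op c a' \<psi> = T a \<psi>"
      "b' \<in> Ah h" "\<forall>\<psi>. series_op c b' \<psi> = T b \<psi>" by blast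
    with mult.hyps show ?case
      by (intro bexI[of _ "a' * b + a * b'"]) (auto simp: T_mult intro: Ah.add Ah.mult)
  qed
  then obtain \<delta> where \<delta>: "\<And>a. a \<in> Ah h \<Longrightarrow> \<delta> a \<in> Ah h"
      "\<And>a \<psi>. a \<in> Ah h \<Longrightarrow> series_op c (\<delta> a) \<psi> = T a \<psi>"
    by metis
  define d where "d a = (if a \<in> Ah h then \<delta> a else 0)" for a
  have d: "d a \<in> Ah h" "series_op c (d a) \<psi> = T a \<psi>" if "a \<in> Ah h" for a \<psi>
    using that \<delta> by (auto simp: d_def)
  have "d \<in> Der h"
  proof (rule DerI)
    fix a b assume a: "a \<in> Ah h" and b: "b \<in> Ah h"
    show "d (a + b) = d a + d b"
      by (rule series_op_faithful[of c]) (simp add: d a b Ah.add, simp add: T_def ring_distribs)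
    show "d (a * b) = d a * b + a * d b"
      by (rule series_op_faithful[of c]) (simp add: d a b Ah.mult T_mult)
  next
    fix k a assume a: "a \<in> Ah h"
    show "d (wscale k a) = wscale k (d a)"
      by (rule series_op_faithful[of c])
        (simp add: d a Ah_scale, simp add: T_def wscale_def d a algebra_simps)
  qed (simp_all add: d_def \<delta>)
  moreover have "d wx = 0"
    by (rule series_op_faithful[of c]) (simp add: d Ah.x, simp add: T_def)
  moreover have "d (yhat h) = wpoly g"
    by (rule series_op_faithful[of c]) (simp add: d Ah.yhat T_yhat series_op_wpoly G_def)
  ultimately show ?thesis by blast
qed

lemma D_spec:
  fixes h :: "'f::field_char_0 poly"
  assumes "h \<noteq> 0"
  shows "D h g \<in> Der h" "D h g wx = 0" "D h g (yhat h) = wpoly g"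
proof -
  have "\<exists>!d. d \<in> Der h \<and> d wx = 0 \<and> d (yhat h) = wpoly g"
    using D_exists[OF assms] by (metis Der_eqI)
  from theI'[OF this]
  show "D h g \<in> Der h" "D h g wx = 0" "D h g (yhat h) = wpoly g"
    by (simp_all add: D_def)
qed

lemma D_eqI:
  fixes h :: "'f::field_char_0 poly"
  assumes "h \<noteq> 0" "d \<in> Der h" "d wx = 0" "d (yhat h) = wpoly g"
  shows "D h g = d"
  using assms D_spec[of h g] by (intro Der_eqI) auto

lemma D_0:
  fixes h :: "'f::field_char_0 poly"
  assumes "h \<noteq> 0" shows "D h 0 = 0"
  using maps.subspace_0[OF subspace_Der] by (intro D_eqI assms) simp_all

lemma D_add:
  fixes h :: "'f::field_char_0 poly"
  assumes "h \<noteq> 0" shows "D h (f + g) = D h f + D h g"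
  using D_spec[OF assms]
  by (intro D_eqI assms maps.subspace_add[OF subspace_Der]) (simp_all add: wpoly_add)

lemma D_smult:
  fixes h :: "'f::field_char_0 poly"
  assumes "h \<noteq> 0" shows "D h (smult c g) = fscale c (D h g)"
  using D_spec[OF assms]
  by (intro D_eqI assms maps.subspace_scale[OF subspace_Der])
    (simp_all add: wpoly_smult fscale_def wscale_def)

lemma D_mult_h:
  fixes h :: "'f::field_char_0 poly"
  assumes "h \<noteq> 0" shows "D h (h * pderiv p) = ad h (wpoly (- p))"
proof (rule D_eqI[OF assms])
  show "ad h (wpoly (- p)) \<in> Der h"
    using Ah_wpoly Ah_subset_normalizer by (intro ad_in_Der) blast
  show "ad h (wpoly (- p)) wx = 0"
    unfolding ad_wx unfolding wx_eq_wpoly by (rule commutator_wpoly_wpoly)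
  show "ad h (wpoly (- p)) (yhat h) = wpoly (h * pderiv p)"
    unfolding ad_yhat commutator_wpoly_yhat by (simp add: pderiv_minus wpoly_minus)
qed

lemma Der_eq_commutator_on_wpoly:
  assumes "d \<in> Der h" "d wx = commutator u wx"
  shows "d (wpoly p) = commutator u (wpoly p)"
  by (induction p)
    (simp_all add: Der_wconst[OF assms(1)] Der_wconst[OF assms(1), of 0, simplified]
      DerD(2,4)[OF assms(1)] Ah.intros Ah_wpoly assms
      commutator_add_right commutator_mult_right commutator_def[of _ 0])

text \<open>
  An operator \<open>u\<close> with \<open>[u, x] = d x\<close> exists because \<open>[\<cdot>, x]\<close> differentiates symbols in \<open>y\<close>. Applying
  \<open>d\<close> and \<open>[u, \<cdot>]\<close> to the defining relation \<open>(yh) x = x (yh) + h\<close> shows that they differ at \<open>yh\<close> by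
  an element commuting with \<open>x\<close>.
\<close>
lemma Der_decompose:
  fixes h :: "'f::field_char_0 poly"
  assumes "h \<noteq> 0" and d: "d \<in> Der h"
  shows "\<exists>g. \<exists>u \<in> normalizer h. d = D h g + ad h u"
proof -
  obtain Q where "d wx = of_symbol Q" using of_symbol_surj by blast
  moreover obtain P where "pderiv P = Q" using symbol_antiderivative by blast
  ultimately obtain u where u: "d wx = commutator u wx" using commutator_wx by metis
  have rel: "yhat h * wx = wx * yhat h + wpoly h"
    by (simp add: yhat_def mult.assoc wx_wpoly_commute[symmetric])
      (simp add: wy_wx ring_distribs flip: mult.assoc)
  have "commutator (d (yhat h) - commutator u (yhat h)) wx = 0"
  proof -
    have "d (yhat h * wx) = d (wx * yhat h + wpoly h)"
      by (simp only: rel)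
    then have "d (yhat h) * wx + yhat h * d wx
        = d wx * yhat h + wx * d (yhat h) + d (wpoly h)"
      by (simp add: DerD(2,4)[OF d] Ah.intros Ah_wpoly)
    moreover have "commutator u (yhat h * wx) = commutator u (wx * yhat h + wpoly h)"
      by (simp only: rel)
    then have "commutator u (yhat h) * wx + yhat h * commutator u wx
        = commutator u wx * yhat h + wx * commutator u (yhat h) + commutator u (wpoly h)"
      by (simp only: commutator_mult_right commutator_add_right)
    moreover have "a - e = a' - e'" if "a + b = k + e + l" "a' + b = k + e' + l"
      for a b k e l a' e' :: "'f weyl"
      unfolding that[THEN eq_diff_eq[THEN iffD2]] by simp
    ultimately have "d (yhat h) * wx - wx * d (yhat h)
        = commutator u (yhat h) * wx - wx * commutator u (yhat h)"
      unfolding Der_eq_commutator_on_wpoly[OF d u] u by blast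
    then show ?thesis
      unfolding commutator_minus_left unfolding commutator_def[of _ wx] by simp
  qed
  then obtain g where g: "d (yhat h) - commutator u (yhat h) = wpoly g"
    using centralizer_wx by blast
  have "u \<in> normalizer h"
    unfolding normalizer_iff_generators
  proof
    show "commutator u wx \<in> Ah h" using DerD(1)[OF d Ah.x] u by simp
    have "commutator u (yhat h) = d (yhat h) - wpoly g" by (simp flip: g)
    then show "commutator u (yhat h) \<in> Ah h"
      using DerD(1)[OF d Ah.yhat] by (simp add: Ah_diff Ah_wpoly)
  qed
  moreover have "d = D h g + ad h u"
  proof (rule Der_eqI[OF d])
    show "D h g + ad h u \<in> Der h"
      using D_spec(1)[OF assms(1)] ad_in_Der[OF \<open>u \<in> normalizer h\<close>]
      by (rule maps.subspace_add[OF subspace_Der])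
    show "d wx = (D h g + ad h u) wx"
      by (simp add: D_spec[OF assms(1)] ad_wx u)
    have "d (yhat h) = wpoly g + commutator u (yhat h)"
      using g by (simp add: diff_eq_eq)
    then show "d (yhat h) = (D h g + ad h u) (yhat h)"
      by (simp add: D_spec[OF assms(1)] ad_yhat)
  qed
  ultimately show ?thesis by blast
qed

section \<open>The direct sum decompositions\<close>

lemma deg_less_0: "q \<noteq> 0 \<Longrightarrow> deg_less 0 q"
  and deg_less_add: "deg_less p q \<Longrightarrow> deg_less p' q \<Longrightarrow> deg_less (p + p') q"
  and deg_less_smult: "deg_less p q \<Longrightarrow> deg_less (smult c p) q" for p q :: "'f::field poly"
  by (auto simp: deg_less_def degree_add_less)

lemma deg_less_mod: "q \<noteq> 0 \<Longrightarrow> deg_less (p mod q) q" for p q :: "'f::field poly"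
  using degree_mod_less by (auto simp: deg_less_def)

lemma deg_less_dvd_eq_0: "deg_less p q \<Longrightarrow> q dvd p \<Longrightarrow> p = 0" for p q :: "'f::field poly"
  using dvd_imp_degree_le by (fastforce simp: deg_less_def)

text \<open>
  Working with this span inside the Weyl algebra, rather than with the span of the derivations,
  makes coefficients available; it is the image under \<open>ad\<close> that enters the theorem.
\<close>
definition Ah_complement :: "'f::field poly \<Rightarrow> 'f weyl set" where
  "Ah_complement h =
    weyl.span {wpoly r * a_elem h n | r n. deg_less r (h div pi_poly h) \<and> n \<ge> 1}"

lemma span_ad_eq: "span_ad h = ad h ` Ah_complement h"
proof -
  have "{ad h (wpoly r * a_elem h n) | r n. deg_less r (h div pi_poly h) \<and> n \<ge> 1}
      = ad h ` {wpoly r * a_elem h n | r n. deg_less r (h div pi_poly h) \<and> n \<ge> 1}"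
    by blast
  then show ?thesis
    unfolding span_ad_def Ah_complement_def by (simp only: module_hom.span_image[OF ad_hom])
qed

lemma a_elem_symbol:
  "wpoly r * a_elem h (Suc n) = of_symbol (monom (r * (pi_poly h * h ^ n)) (Suc n))"
  by (simp add: a_elem_def of_symbol_monom wpoly_mult mult.assoc)

lemma Ah_complement_symbol:
  fixes h :: "'f::field_char_0 poly"
  assumes "h \<noteq> 0" "w \<in> Ah_complement h"
  shows "\<exists>P. w = of_symbol P \<and> coeff P 0 = 0 \<and>
    (\<forall>n. \<exists>r. deg_less r (h div pi_poly h) \<and> coeff P (Suc n) = r * (pi_poly h * h ^ n))"
  using assms(2) unfolding Ah_complement_def
proof (induction rule: weyl.span_induct_alt)
  case base
  have "\<exists>r. deg_less r (h div pi_poly h) \<and> 0 = r * (pi_poly h * h ^ n)" for n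
    by (intro exI[of _ 0]) (simp add: deg_less_0 div_pi_poly_nonzero assms(1))
  then show ?case by (intro exI[of _ 0]) simp
next
  case (step c x y)
  then obtain s m where s: "x = wpoly s * a_elem h m" "deg_less s (h div pi_poly h)" "m \<ge> 1"
    by blast
  then obtain m' where m: "m = Suc m'" by (cases m) auto
  obtain P where P: "y = of_symbol P" "coeff P 0 = 0"
    "\<forall>n. \<exists>r. deg_less r (h div pi_poly h) \<and> coeff P (Suc n) = r * (pi_poly h * h ^ n)"
    using step by blast
  have "wscale c x = of_symbol (smult [:c:] (monom (s * (pi_poly h * h ^ m')) m))"
    by (simp add: wscale_def s m a_elem_symbol of_symbol_smult)
  then have "wscale c x + y
      = of_symbol (monom (smult c s * (pi_poly h * h ^ m')) m + P)"
    by (simp add: P of_symbol_add smult_monom)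
  moreover have "\<exists>r. deg_less r (h div pi_poly h) \<and>
      coeff (monom (smult c s * (pi_poly h * h ^ m')) m + P) (Suc n) = r * (pi_poly h * h ^ n)" for n
  proof -
    obtain r where r: "deg_less r (h div pi_poly h)" "coeff P (Suc n) = r * (pi_poly h * h ^ n)"
      using P by blast
    show ?thesis
    proof (cases "n = m'")
      case True
      with r s m show ?thesis
        by (intro exI[of _ "smult c s + r"])
          (auto simp: deg_less_add deg_less_smult algebra_simps)
    next
      case False
      with r s m show ?thesis by (intro exI[of _ r]) simp
    qed
  qed
  ultimately show ?case
    using P m by (intro exI[of _ "monom (smult c s * (pi_poly h * h ^ m')) m + P"]) simp
qed

lemma Ah_complement_subset_normalizer:
  fixes h :: "'f::field_char_0 poly"
  assumes "h \<noteq> 0"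
  shows "Ah_complement h \<subseteq> normalizer h"
proof
  fix w assume "w \<in> Ah_complement h"
  then obtain P where P: "w = of_symbol P"
    "\<forall>n. \<exists>r. deg_less r (h div pi_poly h) \<and> coeff P (Suc n) = r * (pi_poly h * h ^ n)"
    using Ah_complement_symbol[OF assms] by metis
  then show "w \<in> normalizer h"
    using of_symbol_in_normalizer_iff[OF assms, of P] by (metis dvd_triv_right)
qed

text \<open>
  A coefficient \<open>r \<pi>\<^sub>h h\<^sup>n\<close> at \<open>y\<^sup>n\<^sup>+\<^sup>1\<close> is divisible by \<open>h\<^sup>n\<^sup>+\<^sup>1\<close> only if \<open>h / \<pi>\<^sub>h\<close> divides \<open>r\<close>, which
  the degree bound on \<open>r\<close> excludes unless \<open>r = 0\<close>.
\<close>
lemma Ah_complement_Int_Ah: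
  fixes h :: "'f::field_char_0 poly"
  assumes "h \<noteq> 0" "w \<in> Ah_complement h" "w \<in> Ah h"
  shows "w = 0"
proof -
  obtain P where P: "w = of_symbol P" "coeff P 0 = 0"
    "\<forall>n. \<exists>r. deg_less r (h div pi_poly h) \<and> coeff P (Suc n) = r * (pi_poly h * h ^ n)"
    using Ah_complement_symbol assms by metis
  have "coeff P (Suc n) = 0" for n
  proof -
    obtain r where r: "deg_less r (h div pi_poly h)" "coeff P (Suc n) = r * (pi_poly h * h ^ n)"
      using P by blast
    have "h ^ Suc n = (h div pi_poly h) * (pi_poly h * h ^ n)"
      using pi_poly_dvd[OF assms(1)] by (simp flip: mult.assoc)
    moreover have "h ^ Suc n dvd coeff P (Suc n)"
      using assms(3) unfolding P(1) of_symbol_in_Ah_iff adapted_def by (metis add_0_right)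
    ultimately have "h div pi_poly h dvd r"
      using r assms pi_poly_nonzero by (metis dvd_mult_cancel_right mult_eq_0_iff power_not_zero)
    with r show ?thesis using deg_less_dvd_eq_0 by (metis mult_zero_left)
  qed
  with P have "coeff P n = 0" for n by (cases n) simp_all
  then show ?thesis by (simp add: P poly_eq_iff)
qed

text \<open>
  In the coefficient \<open>s \<pi>\<^sub>h h\<^sup>m\<close> of \<open>y\<^sup>m\<^sup>+\<^sup>1\<close>, the multiples of \<open>h / \<pi>\<^sub>h\<close> in \<open>s\<close> contribute elements of
  \<open>A\<^sub>h\<close>, so only the remainder of \<open>s\<close> modulo \<open>h / \<pi>\<^sub>h\<close> counts.
\<close>
lemma normalizer_decompose:
  fixes h :: "'f::field_char_0 poly"
  assumes "h \<noteq> 0" "u \<in> normalizer h"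
  shows "\<exists>w \<in> Ah_complement h. \<exists>a \<in> Ah h. u = w + a"
proof -
  define S where "S = {w + a | w a. w \<in> Ah_complement h \<and> a \<in> Ah h}"
  have S: "weyl.subspace S"
    unfolding S_def Ah_complement_def by (intro weyl.subspace_sums weyl.subspace_span subspace_Ah)
  have Ah_S: "a \<in> S" if "a \<in> Ah h" for a
    using that weyl.span_zero unfolding S_def Ah_complement_def by force
  have compl_S: "w \<in> S" if "w \<in> Ah_complement h" for w
    using that Ah_zero unfolding S_def by force
  obtain P where u: "u = of_symbol P" using of_symbol_surj by blast
  have "wpoly (coeff P n) * wy ^ n \<in> S" for n
  proof (cases n)
    case 0
    then show ?thesis by (simp add: Ah_S Ah_wpoly)
  next
    case (Suc m)
    define k where "k = h div pi_poly h"
    have k: "k * pi_poly h = h" using pi_poly_dvd[OF assms(1)] by (simp add: k_def)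
    obtain s where s: "coeff P n = s * (pi_poly h * h ^ m)"
      using assms u Suc of_symbol_in_normalizer_iff by (metis dvdE mult.commute)
    have "(s div k) * h ^ n = (s div k) * (k * pi_poly h * h ^ m)"
      by (simp only: k Suc power_Suc)
    then have "coeff P n = (s mod k) * (pi_poly h * h ^ m) + (s div k) * h ^ n"
      unfolding s by (metis add.commute div_mult_mod_eq mult.assoc semiring_class.distrib_right)
    then have "wpoly (coeff P n) * wy ^ n
        = wpoly (s mod k) * a_elem h n + wpoly (s div k * h ^ n) * wy ^ n"
      by (simp add: wpoly_add wpoly_mult a_elem_def Suc ring_distribs mult.assoc)
    moreover have "deg_less (s mod k) k"
      using k assms by (intro deg_less_mod) (metis mult_zero_left)
    then have "wpoly (s mod k) * a_elem h n \<in> Ah_complement h"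
      unfolding Ah_complement_def k_def[symmetric] using Suc
      by (intro weyl.span_base) auto
    moreover have "wpoly (s div k * h ^ n) * wy ^ n \<in> Ah h"
      by (intro Ah_monomial) simp
    ultimately show ?thesis
      using weyl.subspace_add[OF S] Ah_S compl_S by metis
  qed
  then have "u \<in> S"
    unfolding u of_symbol_def by (intro weyl.subspace_sum[OF S])
  then show ?thesis unfolding S_def by blast
qed

lemma EE_eq:
  fixes h :: "'f::field_char_0 poly"
  assumes "h \<noteq> 0"
  shows "EE h = span_ad h + Inder h"
proof (intro equalityI subsetI)
  fix e assume "e \<in> EE h"
  then obtain u where "u \<in> normalizer h" "e = ad h u" by (auto simp: EE_def)
  then show "e \<in> span_ad h + Inder h"
    using normalizer_decompose[OF assms]
    by (fastforce simp: span_ad_eq Inder_def ad_add intro: set_plus_intro)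
next
  fix e assume "e \<in> span_ad h + Inder h"
  then obtain w a where "w \<in> Ah_complement h" "a \<in> Ah h" "e = ad h (w + a)"
    by (auto simp: span_ad_eq Inder_def ad_add elim: set_plus_elim)
  moreover have "w + a \<in> normalizer h" if "w \<in> Ah_complement h" "a \<in> Ah h"
    using that Ah_complement_subset_normalizer[OF assms] Ah_subset_normalizer
    by (intro weyl.subspace_add[OF subspace_normalizer]) auto
  ultimately show "e \<in> EE h" by (auto simp: EE_def)
qed

text \<open>
  If \<open>ad w = ad a\<close> with \<open>a \<in> A\<^sub>h\<close>, then \<open>w - a\<close> commutes with \<open>x\<close> and is a polynomial, so \<open>w\<close>
  itself lies in \<open>A\<^sub>h\<close>, which meets the complement trivially.
\<close>
lemma span_ad_Int_Inder:
  fixes h :: "'f::field_char_0 poly"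
  assumes "h \<noteq> 0"
  shows "span_ad h \<inter> Inder h \<subseteq> {0}"
proof
  fix e assume "e \<in> span_ad h \<inter> Inder h"
  then obtain w a where wa: "w \<in> Ah_complement h" "a \<in> Ah h" "e = ad h w" "ad h w = ad h a"
    by (auto simp: span_ad_eq Inder_def)
  have "ad h (w - a) = 0"
    using wa module_hom.diff[OF ad_hom, of h w a] by simp
  then have "commutator (w - a) wx = 0"
    by (simp flip: ad_wx[of h])
  then obtain p where p: "w - a = wpoly p" using centralizer_wx by blast
  then have "w = wpoly p + a" by (simp add: algebra_simps)
  then have "w \<in> Ah h" using wa by (simp add: Ah.add Ah_wpoly)
  then have "w = 0" using wa assms Ah_complement_Int_Ah by blast
  then show "e \<in> {0}" using wa(3) module_hom.zero[OF ad_hom, of h] by simp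
qed

lemma subspace_Inder: "maps.subspace (Inder h)"
  unfolding Inder_def by (rule module_hom.subspace_image[OF ad_hom subspace_Ah])

lemma subspace_EE: "maps.subspace (EE h)"
  unfolding EE_def by (rule module_hom.subspace_image[OF ad_hom subspace_normalizer])

lemma subspace_span_ad: "maps.subspace (span_ad h)"
  unfolding span_ad_def by (rule maps.subspace_span)

lemma subspace_DD:
  fixes h :: "'f::field_char_0 poly"
  assumes "h \<noteq> 0"
  shows "maps.subspace (DD h)"
proof (rule maps.subspaceI)
  show "0 \<in> DD h"
    unfolding DD_def using assms D_0 deg_less_0 by (metis (mono_tags, lifting) mem_Collect_eq)
qed (auto simp: DD_def simp flip: D_add[OF assms] D_smult[OF assms]
    intro: deg_less_add deg_less_smult)

text \<open>
  The inner derivation of \<open>- p\<close> is \<open>D\<^sub>h\<^sub>p\<^sub>'\<close>, and \<open>p'\<close> can be any polynomial; so \<open>g\<close> can be reduced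
  modulo \<open>h\<close> at the cost of an inner derivation.
\<close>
lemma Der_eq:
  fixes h :: "'f::field_char_0 poly"
  assumes "h \<noteq> 0"
  shows "Der h = DD h + EE h"
proof (intro equalityI subsetI)
  fix d assume "d \<in> Der h"
  then obtain g u where gu: "u \<in> normalizer h" "d = D h g + ad h u"
    using Der_decompose[OF assms] by blast
  obtain p where p: "pderiv p = g div h" using poly_antiderivative by blast
  have "g = g mod h + h * pderiv p" by (simp add: p)
  then have "D h g = D h (g mod h) + ad h (wpoly (- p))"
    using D_add[OF assms] D_mult_h[OF assms] by metis
  with gu have "d = D h (g mod h) + ad h (wpoly (- p) + u)"
    by (simp add: ad_add add.assoc)
  moreover have "wpoly (- p) + u \<in> normalizer h"
    using gu Ah_subset_normalizer Ah_wpoly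
    by (blast intro: weyl.subspace_add[OF subspace_normalizer])
  moreover have "deg_less (g mod h) h" using assms by (rule deg_less_mod)
  ultimately show "d \<in> DD h + EE h"
    by (auto simp: DD_def EE_def intro!: set_plus_intro)
next
  fix d assume "d \<in> DD h + EE h"
  then show "d \<in> Der h"
    using D_spec(1)[OF assms] ad_in_Der
    by (auto simp: DD_def EE_def elim!: set_plus_elim intro!: maps.subspace_add[OF subspace_Der])
qed

text \<open>
  If \<open>D\<^sub>g = ad u\<close>, then \<open>u\<close> commutes with \<open>x\<close>, hence is a polynomial, and evaluation at \<open>yh\<close> gives
  \<open>g = - h u'\<close>.
\<close>
lemma DD_Int_EE:
  fixes h :: "'f::field_char_0 poly"
  assumes "h \<noteq> 0"
  shows "DD h \<inter> EE h \<subseteq> {0}"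
proof
  fix d assume "d \<in> DD h \<inter> EE h"
  then obtain g u where gu: "deg_less g h" "d = D h g" "d = ad h u"
    by (auto simp: DD_def EE_def)
  then have gens: "commutator u wx = 0" "commutator u (yhat h) = wpoly g"
    using D_spec[OF assms, of g] by (metis ad_wx, metis ad_yhat)
  then obtain p where "u = wpoly p" using centralizer_wx by blast
  with gens have "g = h * pderiv (- p)"
    by (simp add: commutator_wpoly_yhat pderiv_minus flip: wpoly_minus)
  with gu have "g = 0" using deg_less_dvd_eq_0 by (metis dvd_triv_left)
  with gu show "d \<in> {0}" by (simp add: D_0 assms)
qed

lemma is_direct_sum_singleton:
  assumes "maps.subspace U" shows "is_direct_sum U [U]"
proof -
  have "listset [U] = (\<lambda>x. [x]) ` U" by (auto simp: set_Cons_def)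
  with assms show ?thesis
    by (simp add: is_direct_sum_def bij_betw_def inj_on_def image_image)
qed

lemma is_direct_sum_Cons:
  assumes V: "is_direct_sum V Us" and U: "maps.subspace U" and "U \<inter> V \<subseteq> {0}"
  shows "is_direct_sum (U + V) (U # Us)"
proof -
  have sub: "maps.subspace V" and inj: "inj_on sum_list (listset Us)"
    and img: "sum_list ` listset Us = V"
    using V by (auto simp: is_direct_sum_def bij_betw_def)
  have "U + V = {x + y | x y. x \<in> U \<and> y \<in> V}"
    by (auto simp: set_plus_def)
  then have "maps.subspace (U + V)"
    using maps.subspace_sums[OF U sub] by simp
  moreover have "inj_on sum_list (listset (U # Us))"
  proof (rule inj_onI)
    fix xs ys assume "xs \<in> listset (U # Us)" "ys \<in> listset (U # Us)" "sum_list xs = sum_list ys"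
    then obtain x xs' y ys' where *: "xs = x # xs'" "ys = y # ys'" "x \<in> U" "y \<in> U"
      "xs' \<in> listset Us" "ys' \<in> listset Us" "x + sum_list xs' = y + sum_list ys'"
      by (auto simp: set_Cons_def)
    have "x - y = sum_list ys' - sum_list xs'"
      using *(7) by (simp add: algebra_simps)
    moreover have "x - y \<in> U" using * by (intro maps.subspace_diff[OF U])
    moreover have "sum_list ys' - sum_list xs' \<in> V"
      using * img by (intro maps.subspace_diff[OF sub]) auto
    ultimately have "x = y" "sum_list ys' = sum_list xs'"
      using assms(3) by auto
    with * inj show "xs = ys" by (auto dest: inj_onD)
  qed
  moreover have "sum_list ` listset (U # Us) = U + V"
  proof (intro equalityI subsetI)
    fix z assume "z \<in> sum_list ` listset (U # Us)"
    then show "z \<in> U + V" using img by (auto simp: set_Cons_def intro!: set_plus_intro)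
  next
    fix z assume "z \<in> U + V"
    then obtain x xs where "x \<in> U" "xs \<in> listset Us" "z = sum_list (x # xs)"
      using img by (auto elim!: set_plus_elim)
    then show "z \<in> sum_list ` listset (U # Us)"
      by (intro image_eqI[of _ _ "x # xs"]) (auto simp: set_Cons_def)
  qed
  ultimately show ?thesis
    using V U by (auto simp: is_direct_sum_def bij_betw_def)
qed

lemma is_HH1_iso_complement:
  assumes W: "maps.subspace W" and Der: "Der h = W + Inder h" and "W \<inter> Inder h \<subseteq> {0}"
  shows "is_HH1_iso h W (\<lambda>d. d +o Inder h)"
proof -
  note I = subspace_Inder[of h]
  have I_add: "Inder h + Inder h = Inder h"
  proof (intro equalityI subsetI)
    fix x assume "x \<in> Inder h"
    then show "x \<in> Inder h + Inder h"
      using set_plus_intro[OF maps.subspace_0[OF I], of x "Inder h"] by simp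
  qed (auto elim!: set_plus_elim intro: maps.subspace_add[OF I])
  have absorb: "(d + i) +o Inder h = d +o Inder h" if "i \<in> Inder h" for d i
  proof -
    have "i +o Inder h = Inder h"
    proof (intro equalityI subsetI)
      fix x assume "x \<in> Inder h"
      then have "x - i \<in> Inder h" using that by (intro maps.subspace_diff[OF I])
      then show "x \<in> i +o Inder h" by (force simp: elt_set_plus_def)
    qed (auto simp: elt_set_plus_def that intro: maps.subspace_add[OF I])
    then show ?thesis by (metis set_plus_rearrange2)
  qed
  have "inj_on (\<lambda>d. d +o Inder h) W"
  proof (rule inj_onI)
    fix d e assume de: "d \<in> W" "e \<in> W" "d +o Inder h = e +o Inder h"
    have "d \<in> d +o Inder h"
      using maps.subspace_0[OF I] by (force simp: elt_set_plus_def)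
    then have "d \<in> e +o Inder h"
      using de by simp
    then have "d - e \<in> Inder h" by (auto simp: elt_set_plus_def)
    moreover have "d - e \<in> W" using de by (intro maps.subspace_diff[OF W])
    ultimately show "d = e" using assms(3) by auto
  qed
  moreover have "(\<lambda>d. d +o Inder h) ` W = HH1 h"
  proof (intro equalityI subsetI)
    fix A assume "A \<in> (\<lambda>d. d +o Inder h) ` W"
    then obtain d where "d \<in> W" "A = d +o Inder h" by blast
    moreover have "d \<in> Der h" if "d \<in> W" for d
      unfolding Der using set_plus_intro[OF that maps.subspace_0[OF I]] by simp
    ultimately show "A \<in> HH1 h" by (auto simp: HH1_def)
  next
    fix A assume "A \<in> HH1 h"
    then obtain w i where "w \<in> W" "i \<in> Inder h" "A = (w + i) +o Inder h"
      by (auto simp: HH1_def Der elim!: set_plus_elim)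
    then show "A \<in> (\<lambda>d. d +o Inder h) ` W" by (auto simp: absorb)
  qed
  moreover have "(d + e) +o Inder h = (d +o Inder h) + (e +o Inder h)" for d e
    by (simp add: set_plus_rearrange I_add)
  moreover have "fscale c d +o Inder h = HH1_scale h c (d +o Inder h)" for c d
  proof (intro equalityI subsetI)
    fix x assume "x \<in> fscale c d +o Inder h"
    then obtain i where i: "i \<in> Inder h" "x = fscale c d + i" by (auto simp: elt_set_plus_def)
    have "d \<in> d +o Inder h"
      using maps.subspace_0[OF I] by (force simp: elt_set_plus_def)
    with i show "x \<in> HH1_scale h c (d +o Inder h)"
      unfolding HH1_scale_def by (auto intro: set_plus_intro)
  next
    fix x assume "x \<in> HH1_scale h c (d +o Inder h)"
    then obtain i j where ij: "i \<in> Inder h" "j \<in> Inder h" "x = fscale c (d + i) + j"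
      by (auto simp: HH1_scale_def elt_set_plus_def elim!: set_plus_elim)
    then have "x = fscale c d + (fscale c i + j)"
      by (simp add: maps.scale_right_distrib add.assoc)
    moreover have "fscale c i + j \<in> Inder h"
      using ij by (intro maps.subspace_add[OF I] maps.subspace_scale[OF I])
    ultimately show "x \<in> fscale c d +o Inder h" by (auto simp: elt_set_plus_def)
  qed
  ultimately show ?thesis
    by (simp add: is_HH1_iso_def bij_betw_def)
qed

theorem theorem5p7:
  fixes h :: "'f::field_char_0 poly"
  assumes "h \<noteq> 0"
  shows "is_direct_sum (EE h) [span_ad h, Inder h]
    \<and> is_direct_sum (Der h) [DD h, span_ad h, Inder h]
    \<and> is_direct_sum (DD h + span_ad h) [DD h, span_ad h]
    \<and> is_HH1_iso h (DD h + span_ad h) (\<lambda>d. d +o Inder h)"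
proof -
  have E: "is_direct_sum (EE h) [span_ad h, Inder h]"
    unfolding EE_eq[OF assms]
    by (intro is_direct_sum_Cons is_direct_sum_singleton subspace_Inder subspace_span_ad
        span_ad_Int_Inder assms)
  have Der: "is_direct_sum (Der h) [DD h, span_ad h, Inder h]"
    unfolding Der_eq[OF assms]
    by (intro is_direct_sum_Cons[OF E] subspace_DD DD_Int_EE assms)
  have sub: "span_ad h \<subseteq> EE h" "Inder h \<subseteq> EE h"
    using Ah_complement_subset_normalizer[OF assms] Ah_subset_normalizer
    by (auto simp: span_ad_eq EE_def Inder_def)
  have W: "is_direct_sum (DD h + span_ad h) [DD h, span_ad h]"
    using DD_Int_EE[OF assms] sub
    by (intro is_direct_sum_Cons is_direct_sum_singleton subspace_span_ad subspace_DD assms) blast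
  have "is_HH1_iso h (DD h + span_ad h) (\<lambda>d. d +o Inder h)"
  proof (rule is_HH1_iso_complement)
    show "maps.subspace (DD h + span_ad h)"
      using W by (simp add: is_direct_sum_def)
    show "Der h = DD h + span_ad h + Inder h"
      by (simp add: Der_eq EE_eq assms add.assoc)
    show "(DD h + span_ad h) \<inter> Inder h \<subseteq> {0}"
    proof
      fix x assume "x \<in> (DD h + span_ad h) \<inter> Inder h"
      then obtain d s where ds: "d \<in> DD h" "s \<in> span_ad h" "d + s \<in> Inder h" "x = d + s"
        by (auto elim!: set_plus_elim)
      then have "(d + s) - s \<in> EE h"
        using sub by (intro maps.subspace_diff[OF subspace_EE]) auto
      then have "d = 0" using ds DD_Int_EE[OF assms] by auto
      then show "x \<in> {0}" using ds span_ad_Int_Inder[OF assms] by auto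
    qed
  qed
  with E Der W show ?thesis by blast
qed

end
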